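(* Let $f,g:\mathbb{R}^n\to(-\infty,\infty]$ be proper lower semicontinuous, with $\mathrm{dom} f$ open and $f$ continuously differentiable on $\mathrm{dom} f$. Let $\bar x\in\mathcal{X}^\pi:=\{x:0\in\nabla f(x)+\partial^\pi g(x)\}$, suppose that $\nabla f$ is Lipschitz continuous around $\bar x$, and suppose that $\mathrm{gph}(\partial^\pi g)$ is closed near the point $(\bar x,-\nabla f(\bar x))$. Then the set-valued map $\mathcal{S}_{cano}(p):=\{x:p\in\nabla f(x)+\partial^\pi g(x)\}$ is calm at $(0,\bar x)$ if one of the following conditions holds. 1. The mapping $\nabla f$ is piecewise affine and $\partial^\pi g$ is a polyhedral multifunction. 2. NNAMCQ holds at $\bar x$: $$0\in\xi+\partial\langle-\nabla f,\eta\rangle(\bar x),\ (\xi,\eta)\in\mathcal{N}_{\mathrm{gph}(\partial^\pi g)}(\bar x,-\nabla f(\bar x))\ \Longrightarrow\ (\xi,\eta)=0.$$ When $g$ is separable, i.e. $g(x)=\sum_{i=1}^n g_i(x_i)$, and $f$ is twice continuously differentiable, NNAMCQ holds at $\bar x$ if $$0=\xi_i-\nabla f_{x_i}(\bar x)^T\eta,\ (\xi_i,\eta_i)\in\mathcal{N}_{\mathrm{gph}(\partial^\pi g_i)}(\bar x_i,-f_{x_i}(\bar x)),\ i=1,\dots,n\ \Longrightarrow\ (\xi,\eta)=0.$$ 3. FOSCMS holds at $\bar x$: $f$ is twice continuously differentiable and for every $w\ne0$ such that $(w,-\nabla^2f(\bar x)w)\in\mathcal{T}_{\mathrm{gph}(\partial^\pi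 g)}(\bar x,-\nabla f(\bar x))$ one has $$0=\xi-\nabla^2f(\bar x)^T\eta,\ (\xi,\eta)\in\mathcal{N}_{\mathrm{gph}(\partial^\pi g)}\bigl((\bar x,-\nabla f(\bar x));(w,-\nabla^2f(\bar x)w)\bigr)\ \Longrightarrow\ (\xi,\eta)=0.$$ When $g$ is separable, FOSCMS holds at $\bar x$ provided that $f$ is twice continuously differentiable and for every $w\neq0$ such that $(w_i,-\nabla f_{x_i}(\bar x)^Tw)\in\mathcal{T}_{\mathrm{gph}(\partial^\pi g_i)}(\bar x_i,-f_{x_i}(\bar x))$, $i=1,\dots,n$, one has $$0=\xi_i-\nabla f_{x_i}(\bar x)^T\eta,\ (\xi_i,\eta_i)\in\mathcal{N}_{\mathrm{gph}(\partial^\pi g_i)}\bigl((\bar x_i,-f_{x_i}(\bar x));(w_i,-\nabla f_{x_i}(\bar x)^Tw)\bigr),\ i=1,\dots,n\ \Longrightarrow\ (\xi,\eta)=0.$$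
   Context: Proximal subdifferential: for $x_0\in\mathrm{dom}\,\phi=\{\phi<\infty\}$, $\partial^\pi\phi(x_0)$ is the set of $\xi$ for which there exist $\sigma,\eta>0$ with $\phi(x)\ge\phi(x_0)+\langle\xi,x-x_0\rangle-\sigma\|x-x_0\|^2$ for all $x$ in the open ball $\mathbb{B}(x_0,\eta)$; it is empty outside $\mathrm{dom}\,\phi$. Limiting subdifferential: $\partial\phi(x_0)$ is the set of $\xi$ for which there are $x_k\to x_0$ with $\phi(x_k)\to\phi(x_0)$ and $\xi_k\in\partial^\pi\phi(x_k)$ with $\xi_k\to\xi$. In condition 2, $\partial\langle-\nabla f,\eta\rangle(\bar x)$ is the limiting subdifferential at $\bar x$ of the real-valued function $x\mapsto-\langle\nabla f(x),\eta\rangle$. $f_{x_i}$ denotes the partial derivative of $f$ with respect to $x_i$, $\nabla f_{x_i}$ its gradient, $\nabla^2 f$ the Hessian. In the separable case each $g_i:\mathbb{R}\to(-\infty,\infty]$ is proper lower semicontinuous. $\mathrm{gph}\,\Phi:=\{(x,y):y\in\Phi(x)\}$. A mapping is piecewise affine if its domain is a finite union of polyhedral convex sets on each of which it is affine. A polyhedral multifunction is a set-valued map whose graph is the union of finitely many polyhedral convex sets. For $D\subseteq\mathbb{R}^d$, $\bar z\in D$: tangent cone $\mathcal{T}_D(\bar z):=\{u:\exists u^k\to u,\ t^k\downarrow0,\ \bar z+t^ku^k\in D\ \forall k\}$; regular normal cone $\widehat{\mathcal{N}}_D(\bar z):=\{v:\langle v,z-\bar z\rangle\le o(\|z-\bar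 z\|)\text{ for }z\in D\}$ (normal cones at points outside $D$ are empty); limiting normal cone $\mathcal{N}_D(\bar z):=\{v:\exists z^k\to\bar z,\ z^k\in D,\ v^k\to v,\ v^k\in\widehat{\mathcal{N}}_D(z^k)\ \forall k\}$; directional limiting normal cone in direction $d$: $\mathcal{N}_D(\bar z;d):=\{v:\exists t^k\downarrow0,\ v^k\to v,\ d^k\to d,\ v^k\in\widehat{\mathcal{N}}_D(\bar z+t^kd^k)\ \forall k\}$. Calmness: $\mathcal{S}:\mathbb{R}^s\rightrightarrows\mathbb{R}^d$ is calm at $(\bar p,\bar x)$, $\bar x\in\mathcal{S}(\bar p)$, if there exist neighborhoods $\mathbb{U}(\bar p)$, $\mathbb{U}(\bar x)$ and $\kappa\ge0$ such that $\mathcal{S}(p)\cap\mathbb{U}(\bar x)\subseteq\mathcal{S}(\bar p)+\kappa\|p-\bar p\|\overline{\mathbb{B}}$ for all $p\in\mathbb{U}(\bar p)$, with $\overline{\mathbb{B}}$ the closed unit ball. *)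

theory Defs
  imports "HOL-Analysis.Analysis" "HOL-Library.Set_Algebras"
begin

section \<open>Extended-real-valued functions\<close>

definition edom :: "('a \<Rightarrow> ereal) \<Rightarrow> 'a set" where
  "edom \<phi> = {x. \<phi> x < \<infinity>}"

definition proper :: "('a \<Rightarrow> ereal) \<Rightarrow> bool" where
  "proper \<phi> \<longleftrightarrow> (\<forall>x. \<phi> x \<noteq> -\<infinity>) \<and> edom \<phi> \<noteq> {}"

definition lsc :: "('a::topological_space \<Rightarrow> ereal) \<Rightarrow> bool" where
  "lsc \<phi> \<longleftrightarrow> (\<forall>x. \<phi> x \<le> Liminf (at x) \<phi>)"

definition separable :: "(real^'n \<Rightarrow> ereal) \<Rightarrow> ('n \<Rightarrow> real \<Rightarrow> ereal) \<Rightarrow> bool" where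
  "separable g gs \<longleftrightarrow>
     (\<forall>i. proper (gs i) \<and> lsc (gs i)) \<and> (\<forall>x. g x = (\<Sum>i\<in>UNIV. gs i (x $ i)))"


section \<open>Classical derivatives\<close>

text \<open>
  For an extended-real-valued \<open>f\<close> with open domain, the classical derivatives at a point of
  \<open>edom f\<close> are those of \<open>real_of_ereal \<circ> f\<close>. The values of \<open>grad\<close>, \<open>partial_deriv\<close> and
  \<open>hessian\<close> at points where the derivative in question does not exist are unspecified.
\<close>

definition grad :: "('a::real_inner \<Rightarrow> real) \<Rightarrow> 'a \<Rightarrow> 'a" where
  "grad \<phi> x = (THE v. GDERIV \<phi> x :> v)"

definition partial_deriv :: "(real^'n \<Rightarrow> real) \<Rightarrow> 'n \<Rightarrow> real^'n \<Rightarrow> real" where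
  "partial_deriv \<phi> i x = deriv (\<lambda>t. \<phi> (x + t *\<^sub>R axis i 1)) 0"

definition hessian :: "(real^'n \<Rightarrow> real) \<Rightarrow> real^'n \<Rightarrow> real^'n^'n" where
  "hessian \<phi> x = jacobian (grad \<phi>) (at x)"

definition C1_on :: "'a::real_inner set \<Rightarrow> ('a \<Rightarrow> real) \<Rightarrow> bool" where
  "C1_on S \<phi> \<longleftrightarrow> (\<forall>x\<in>S. \<phi> differentiable (at x)) \<and> continuous_on S (grad \<phi>)"

definition C2_on :: "(real^'n) set \<Rightarrow> (real^'n \<Rightarrow> real) \<Rightarrow> bool" where
  "C2_on S \<phi> \<longleftrightarrow> C1_on S \<phi> \<and> (\<forall>x\<in>S. grad \<phi> differentiable (at x)) \<and>
     continuous_on S (hessian \<phi>)"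

abbreviation egrad :: "('a::real_inner \<Rightarrow> ereal) \<Rightarrow> 'a \<Rightarrow> 'a" where
  "egrad f \<equiv> grad (real_of_ereal \<circ> f)"

abbreviation epartial :: "(real^'n \<Rightarrow> ereal) \<Rightarrow> 'n \<Rightarrow> real^'n \<Rightarrow> real" where
  "epartial f \<equiv> partial_deriv (real_of_ereal \<circ> f)"

abbreviation ehessian :: "(real^'n \<Rightarrow> ereal) \<Rightarrow> real^'n \<Rightarrow> real^'n^'n" where
  "ehessian f \<equiv> hessian (real_of_ereal \<circ> f)"

definition lipschitz_around :: "('a::metric_space \<Rightarrow> 'b::metric_space) \<Rightarrow> 'a set \<Rightarrow> 'a \<Rightarrow> bool" where
  "lipschitz_around F D x \<longleftrightarrow> (\<exists>U L. open U \<and> x \<in> U \<and> U \<subseteq> D \<and> L-lipschitz_on U F)"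


section \<open>Subdifferentials\<close>

definition prox_subdiff :: "('a::real_inner \<Rightarrow> ereal) \<Rightarrow> 'a \<Rightarrow> 'a set" where
  "prox_subdiff \<phi> x0 = {\<xi>. x0 \<in> edom \<phi> \<and>
     (\<exists>\<sigma>>0. \<exists>\<eta>>0. \<forall>x\<in>ball x0 \<eta>. \<phi> x \<ge> \<phi> x0 + ereal (\<xi> \<bullet> (x - x0) - \<sigma> * (norm (x - x0))\<^sup>2))}"

definition lim_subdiff :: "('a::real_inner \<Rightarrow> ereal) \<Rightarrow> 'a \<Rightarrow> 'a set" where
  "lim_subdiff \<phi> x0 = {\<xi>. \<exists>xs \<xi>s. xs \<longlonglongrightarrow> x0 \<and> (\<lambda>k. \<phi> (xs k)) \<longlonglongrightarrow> \<phi> x0 \<and>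
     (\<forall>k. \<xi>s k \<in> prox_subdiff \<phi> (xs k)) \<and> \<xi>s \<longlonglongrightarrow> \<xi>}"


section \<open>Set-valued maps\<close>

definition gph :: "('a \<Rightarrow> 'b set) \<Rightarrow> ('a \<times> 'b) set" where
  "gph \<Phi> = {(x, y). y \<in> \<Phi> x}"

definition closed_near :: "'a::metric_space set \<Rightarrow> 'a \<Rightarrow> bool" where
  "closed_near D z \<longleftrightarrow> (\<exists>r>0. closed (D \<inter> cball z r))"

definition polyhedral_multifunction ::
    "('a::euclidean_space \<Rightarrow> 'b::euclidean_space set) \<Rightarrow> bool" where
  "polyhedral_multifunction \<Phi> \<longleftrightarrow>
     (\<exists>\<C>. finite \<C> \<and> (\<forall>C\<in>\<C>. polyhedron C) \<and> gph \<Phi> = \<Union>\<C>)"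

definition piecewise_affine_on ::
    "'a::euclidean_space set \<Rightarrow> ('a \<Rightarrow> 'b::euclidean_space) \<Rightarrow> bool" where
  "piecewise_affine_on D F \<longleftrightarrow>
     (\<exists>\<C>. finite \<C> \<and> D = \<Union>\<C> \<and>
       (\<forall>C\<in>\<C>. polyhedron C \<and> (\<exists>A b. linear A \<and> (\<forall>x\<in>C. F x = A x + b))))"

definition calm_at ::
    "('a::real_normed_vector \<Rightarrow> 'b::real_normed_vector set) \<Rightarrow> 'a \<Rightarrow> 'b \<Rightarrow> bool" where
  "calm_at S pbar xbar \<longleftrightarrow> xbar \<in> S pbar \<and>
     (\<exists>V U \<kappa>. open V \<and> pbar \<in> V \<and> open U \<and> xbar \<in> U \<and> \<kappa> \<ge> 0 \<and>
       (\<forall>p\<in>V. S p \<inter> U \<subseteq> S pbar + (*\<^sub>R) (\<kappa> * norm (p - pbar)) ` cball 0 1))"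


section \<open>Tangent and normal cones\<close>

text \<open>
  As usual in variational analysis, \<open>t\<^sup>k \<down> 0\<close> means \<open>t\<^sup>k > 0\<close> and \<open>t\<^sup>k \<rightarrow> 0\<close>, with no monotonicity.
\<close>

definition tangent_cone :: "'a::real_normed_vector set \<Rightarrow> 'a \<Rightarrow> 'a set" where
  "tangent_cone D z = {u. \<exists>us t. us \<longlonglongrightarrow> u \<and> (\<forall>k. t k > 0) \<and> t \<longlonglongrightarrow> (0::real) \<and>
     (\<forall>k::nat. z + t k *\<^sub>R us k \<in> D)}"

definition regular_normal_cone :: "'a::real_inner set \<Rightarrow> 'a \<Rightarrow> 'a set" where
  "regular_normal_cone D zbar = {v. zbar \<in> D \<and>
     (\<forall>\<epsilon>>0. \<forall>\<^sub>F z in at zbar within D. v \<bullet> (z - zbar) \<le> \<epsilon> * norm (z - zbar))}"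

definition limiting_normal_cone :: "'a::real_inner set \<Rightarrow> 'a \<Rightarrow> 'a set" where
  "limiting_normal_cone D zbar = {v. zbar \<in> D \<and>
     (\<exists>zs vs. zs \<longlonglongrightarrow> zbar \<and> vs \<longlonglongrightarrow> v \<and>
       (\<forall>k::nat. zs k \<in> D \<and> vs k \<in> regular_normal_cone D (zs k)))}"

definition directional_normal_cone :: "'a::real_inner set \<Rightarrow> 'a \<Rightarrow> 'a \<Rightarrow> 'a set" where
  "directional_normal_cone D zbar d = {v. zbar \<in> D \<and>
     (\<exists>t vs ds. (\<forall>k. t k > 0) \<and> t \<longlonglongrightarrow> (0::real) \<and> vs \<longlonglongrightarrow> v \<and> ds \<longlonglongrightarrow> d \<and>
       (\<forall>k::nat. vs k \<in> regular_normal_cone D (zbar + t k *\<^sub>R ds k)))}"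


section \<open>The canonically perturbed stationarity system\<close>

text \<open>
  \<open>\<nabla>f\<close> is only defined on the open set \<open>edom f\<close>, so solutions of the generalized equation
  lie in \<open>edom f\<close>.
\<close>

definition S_cano ::
    "('a::real_inner \<Rightarrow> ereal) \<Rightarrow> ('a \<Rightarrow> ereal) \<Rightarrow> 'a \<Rightarrow> 'a set" where
  "S_cano f g p = {x \<in> edom f. p \<in> egrad f x +o prox_subdiff g x}"

definition prox_stationary ::
    "('a::real_inner \<Rightarrow> ereal) \<Rightarrow> ('a \<Rightarrow> ereal) \<Rightarrow> 'a set" where
  "prox_stationary f g = {x \<in> edom f. 0 \<in> egrad f x +o prox_subdiff g x}"

text \<open>
  Off \<open>edom f\<close> the function \<open>x \<mapsto> -\<langle>\<nabla>f(x), \<eta>\<rangle>\<close> below has unspecified values; they do not matter,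
  since \<open>lim_subdiff\<close> depends only on the values near \<open>xbar\<close>, an interior point of \<open>edom f\<close>.
\<close>

definition NNAMCQ ::
    "('a::real_inner \<Rightarrow> ereal) \<Rightarrow> ('a \<Rightarrow> ereal) \<Rightarrow> 'a \<Rightarrow> bool" where
  "NNAMCQ f g xbar \<longleftrightarrow> (\<forall>\<xi> \<eta>.
     0 \<in> \<xi> +o lim_subdiff (\<lambda>x. ereal (- (egrad f x \<bullet> \<eta>))) xbar \<and>
     (\<xi>, \<eta>) \<in> limiting_normal_cone (gph (prox_subdiff g)) (xbar, - egrad f xbar)
     \<longrightarrow> (\<xi>, \<eta>) = 0)"

definition FOSCMS ::
    "(real^'n \<Rightarrow> ereal) \<Rightarrow> (real^'n \<Rightarrow> ereal) \<Rightarrow> real^'n \<Rightarrow> bool" where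
  "FOSCMS f g xbar \<longleftrightarrow> C2_on (edom f) (real_of_ereal \<circ> f) \<and>
     (\<forall>w. w \<noteq> 0 \<and>
        (w, - (ehessian f xbar *v w)) \<in> tangent_cone (gph (prox_subdiff g)) (xbar, - egrad f xbar)
      \<longrightarrow> (\<forall>\<xi> \<eta>.
        0 = \<xi> - transpose (ehessian f xbar) *v \<eta> \<and>
        (\<xi>, \<eta>) \<in> directional_normal_cone (gph (prox_subdiff g)) (xbar, - egrad f xbar)
                    (w, - (ehessian f xbar *v w))
        \<longrightarrow> (\<xi>, \<eta>) = 0))"

end

theory Submission
  imports Defs
begin

text \<open>
  Calmness of \<open>p \<mapsto> {x. (x, p - \<nabla>f x) \<in> D}\<close> with \<open>D = gph (prox_subdiff g)\<close> is a local error bound for the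
  residual \<open>\<parallel>v + \<nabla>f x\<parallel>\<close> on \<open>D\<close>. In the polyhedral case this is Hoffman's lemma. Otherwise, if the error bound
  fails, Ekeland's principle gives points of \<open>D\<close> with nonzero residual, tending to the reference point
  \<open>(xbar, - \<nabla>f xbar)\<close>, which are local minimizers of the residual up to a vanishing multiple of the distance.
  The optimality conditions there provide almost normal vectors \<open>(\<xi>, \<eta>)\<close> to \<open>D\<close> with \<open>\<parallel>\<eta>\<parallel> = 1\<close>, whose limits
  violate NNAMCQ. Keeping track of the direction of approach, they also violate FOSCMS.
\<close>

text \<open>Minimization yields inequalities with an error proportional to the distance, whereas the
  cones are built from exact regular normals; \<open>regular_normal_near\<close> passes from one to
  the other at the price of a factor 2 and a small move of the base point. A nonzero residual
  matters because the norm is differentiable there with a unit gradient, which is where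
  \<open>norm \<eta> = 1\<close> comes from.

  The two constraint qualifications part ways over the smoothness of the gradient \<open>G\<close>
  of \<open>f\<close>. Under FOSCMS the residual can be differentiated in both variables. Under
  NNAMCQ \<open>G\<close> is only Lipschitz, so only the outer norm is linearized,
  \<open>\<eta>\<close> is frozen at a limit of the unit residuals, and a fuzzy sum rule splits the
  scalar function \<open>G x \<bullet> \<eta>\<close> from the constraint \<open>D\<close>. The
  normals then have the form \<open>(- \<zeta>, - \<eta>)\<close> with \<open>\<zeta>\<close> a
  subgradient of \<open>G x \<bullet> \<eta>\<close>. This function is
  \<open>- (G x \<bullet> (- \<eta>))\<close>, so the sign convention of NNAMCQ is met by the
  multiplier \<open>- \<eta>\<close>.\<close>

lemma calm_atI:
  fixes S :: "'a::real_normed_vector \<Rightarrow> 'b::real_normed_vector set"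
  assumes "xbar \<in> S 0" "\<kappa> \<ge> 0" "\<delta> > 0"
    and near: "\<And>p x. \<lbrakk>norm p < \<delta>; norm (x - xbar) < \<delta>; x \<in> S p\<rbrakk> \<Longrightarrow> \<exists>y\<in>S 0. norm (x - y) \<le> \<kappa> * norm p"
  shows "calm_at S 0 xbar"
proof -
  have "x \<in> S 0 + (*\<^sub>R) (\<kappa> * norm (p - 0)) ` cball 0 1"
    if p: "p \<in> ball 0 \<delta>" and x: "x \<in> S p \<inter> ball xbar \<delta>" for p x
  proof -
    obtain y where y: "y \<in> S 0" "norm (x - y) \<le> \<kappa> * norm p"
      using near[of p x] p x by (auto simp: dist_norm norm_minus_commute)
    define c where "c = \<kappa> * norm p"
    have "x - y \<in> (*\<^sub>R) c ` cball 0 1"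
    proof (cases "c = 0")
      case True
      with y c_def show ?thesis by (auto intro!: image_eqI[of _ _ 0])
    next
      case False
      with \<open>\<kappa> \<ge> 0\<close> have "c > 0" by (simp add: c_def)
      moreover have "norm (x - y) \<le> c" using y(2) by (simp add: c_def)
      ultimately have "norm ((1/c) *\<^sub>R (x - y)) \<le> 1" by (simp only: norm_scaleR) (simp add: field_simps)
      then show ?thesis using \<open>c > 0\<close> by (intro image_eqI[of _ _ "(1/c) *\<^sub>R (x - y)"]) auto
    qed
    then have "y + (x - y) \<in> S 0 + (*\<^sub>R) c ` cball 0 1"
      using y(1) by (rule set_plus_intro[rotated])
    then show ?thesis by (simp add: c_def)
  qed
  then show ?thesis
    unfolding calm_at_def using assms(1-3)
    by (intro conjI exI[of _ "ball 0 \<delta>"] exI[of _ "ball xbar \<delta>"] exI[of _ \<kappa>]) auto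
qed

section \<open>Polyhedral systems\<close>

text \<open>The unit vector from the nearest solution \<open>y\<close> to \<open>z\<close> lies in a compact set which depends only
  on the constraints active at \<open>y\<close> and on which \<open>L\<close> has no zero. There are finitely many active sets.\<close>

lemma hoffman_error_bound:
  fixes L :: "'a::euclidean_space \<Rightarrow> 'b::euclidean_space"
  assumes "polyhedron Q" "linear L" "y0 \<in> Q" "L y0 = c"
  obtains \<kappa> where "\<kappa> \<ge> 0" "\<And>z. z \<in> Q \<Longrightarrow> \<exists>y\<in>Q. L y = c \<and> norm (z - y) \<le> \<kappa> * norm (L z - c)"
proof -
  interpret L: linear L by fact
  have cL: "continuous_on X L" for X
    using \<open>linear L\<close> by (simp add: linear_continuous_on linear_conv_bounded_linear)
  obtain F where F: "finite F" "Q = \<Inter>F" "\<forall>h\<in>F. \<exists>a b. a \<noteq> 0 \<and> h = {x. a \<bullet> x \<le> b}"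
    using assms(1) unfolding polyhedron_def by blast
  then obtain a b where ab: "\<forall>h\<in>F. h = {x. a h \<bullet> x \<le> b h}" by metis
  have Q: "x \<in> Q \<longleftrightarrow> (\<forall>h\<in>F. a h \<bullet> x \<le> b h)" for x using F(2) ab by auto
  \<comment> \<open>\<open>T J\<close> is the cone of directions respecting the constraints in
    \<open>J\<close>. \<open>C J\<close> holds its unit vectors that are polar to the part of
    \<open>T J\<close> annihilated by \<open>L\<close>, a condition forced by projection onto the
    solution set.\<close>
  define T where "T J = {d. \<forall>h\<in>J. a h \<bullet> d \<le> 0}" for J
  define C where "C J = sphere 0 1 \<inter> (T J \<inter> (\<Inter>e\<in>{e\<in>T J. L e = 0}. {d. e \<bullet> d \<le> 0}))" for J
  have "T J = (\<Inter>h\<in>J. {d. a h \<bullet> d \<le> 0})" for J by (auto simp: T_def)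
  then have "compact (C J)" for J
    unfolding C_def by (auto intro!: compact_Int_closed closed_INT closed_Int closed_halfspace_le)
  \<comment> \<open>If \<open>L d = 0\<close>, then \<open>d\<close> is itself one of the vectors
    \<open>e\<close> in the definition of \<open>C J\<close>, so
    \<open>d \<bullet> d \<le> 0\<close>, against \<open>norm d = 1\<close>.\<close>
  moreover have nz: "norm (L d) > 0" if "d \<in> C J" for d J
  proof -
    have "d \<noteq> 0" "d \<in> T J" using that by (auto simp: C_def)
    then have "\<not> d \<bullet> d \<le> 0" by (simp add: not_le)
    with that have "L d \<noteq> 0" by (auto simp: C_def)
    then show ?thesis by simp
  qed
  moreover have "continuous_on (C J) (\<lambda>d. norm (L d))" for J
    by (intro continuous_intros cL)
  ultimately have "\<exists>m>0. \<forall>d\<in>C J. m \<le> norm (L d)" for J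
  proof (cases "C J = {}")
    case False
    with \<open>compact (C J)\<close> \<open>continuous_on (C J) (\<lambda>d. norm (L d))\<close>
    obtain d where "d \<in> C J" "\<forall>y\<in>C J. norm (L d) \<le> norm (L y)"
      using continuous_attains_inf[of "C J" "\<lambda>d. norm (L d)"] by blast
    then show ?thesis using nz by blast
  qed (auto intro: zero_less_one)
  then obtain m where m: "\<And>J. m J > 0" "\<And>J d. d \<in> C J \<Longrightarrow> m J \<le> norm (L d)" by metis
  define \<mu> where "\<mu> = Min (m ` Pow F)"
  have "finite (m ` Pow F)" "m ` Pow F \<noteq> {}" using F(1) by auto
  then have \<mu>: "\<mu> > 0" "\<And>J. J \<subseteq> F \<Longrightarrow> \<mu> \<le> m J"
    unfolding \<mu>_def using m(1) by (auto intro!: Min_le simp: Min_gr_iff)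
  show ?thesis
  proof (rule that[of "1/\<mu>"])
    show "1/\<mu> \<ge> 0" using \<mu> by simp
    fix z assume z: "z \<in> Q"
    have "closed (Q \<inter> {y. L y = c})"
      using closed_Collect_eq[OF cL continuous_on_const] polyhedron_imp_closed[OF assms(1)] by (rule closed_Int[rotated])
    moreover have "Q \<inter> {y. L y = c} \<noteq> {}" using assms(3,4) by blast
    ultimately obtain y where yQ: "y \<in> Q \<inter> {y. L y = c}"
      and ymin': "\<And>y'. y' \<in> Q \<inter> {y. L y = c} \<Longrightarrow> dist z y \<le> dist z y'"
      using distance_attains_inf[of "Q \<inter> {y. L y = c}" z thesis] by auto
    then have y: "y \<in> Q" "L y = c" and ymin: "\<And>y'. y' \<in> Q \<Longrightarrow> L y' = c \<Longrightarrow> dist z y \<le> dist z y'"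
      by auto
    have "norm (z - y) \<le> (1/\<mu>) * norm (L z - c)"
    proof (cases "z = y")
      case False
      define n where "n = norm (z - y)"
      have n: "n > 0" using False by (simp add: n_def)
      define J where "J = {h\<in>F. a h \<bullet> y = b h}"
      define d where "d = (1/n) *\<^sub>R (z - y)"
      have "d \<in> T J" using z n by (auto simp: T_def d_def J_def Q inner_diff_right divide_simps)
      \<comment> \<open>First-order condition for the nearest solution. Inactive constraints survive
        a small step along \<open>e\<close> and active ones hold since \<open>e \<in> T J\<close>,
        so \<open>y + s *\<^sub>R e\<close> competes with \<open>y\<close>; the comparison of
        squared distances is divided by \<open>s\<close> before \<open>s\<close> tends to 0.\<close>
      moreover have "e \<bullet> (z - y) \<le> 0" if e: "e \<in> T J" "L e = 0" for e
      proof -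
        have "eventually (\<lambda>s. a h \<bullet> (y + s *\<^sub>R e) \<le> b h) (at_right 0)" if h: "h \<in> F" for h
        proof (cases "h \<in> J")
          case True
          have "eventually (\<lambda>s::real. s > 0) (at_right 0)" by (simp add: eventually_at_right_less)
          then show ?thesis
          proof eventually_elim
            case (elim s)
            have "s * (a h \<bullet> e) \<le> 0" using e True elim by (auto simp: T_def mult_le_0_iff)
            then show ?case using True by (simp add: J_def inner_right_distrib)
          qed
        next
          case False
          then have "a h \<bullet> (y + 0 *\<^sub>R e) < b h" using y(1) h by (auto simp: Q J_def less_le)
          moreover have "((\<lambda>s. a h \<bullet> (y + s *\<^sub>R e)) \<longlongrightarrow> a h \<bullet> (y + 0 *\<^sub>R e)) (at_right 0)"
            by (intro tendsto_intros)
          ultimately have "eventually (\<lambda>s. a h \<bullet> (y + s *\<^sub>R e) < b h) (at_right 0)"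
            by (rule order_tendstoD(2)[rotated])
          then show ?thesis by eventually_elim simp
        qed
        then have "eventually (\<lambda>s. \<forall>h\<in>F. a h \<bullet> (y + s *\<^sub>R e) \<le> b h) (at_right 0)"
          using F(1) by (simp add: eventually_ball_finite)
        moreover have "eventually (\<lambda>s::real. s > 0) (at_right 0)" by (simp add: eventually_at_right_less)
        ultimately have "eventually (\<lambda>s. 2 * (e \<bullet> (z - y)) \<le> s * (norm e)\<^sup>2) (at_right 0)"
        proof eventually_elim
          case (elim s)
          have "dist z y \<le> dist z (y + s *\<^sub>R e)"
          proof (rule ymin)
            show "y + s *\<^sub>R e \<in> Q" using elim(1) by (simp add: Q)
            show "L (y + s *\<^sub>R e) = c" using e(2) y(2) by (simp add: L.add L.scaleR)
          qed
          then have "(norm (z - y))\<^sup>2 \<le> (norm ((z - y) - s *\<^sub>R e))\<^sup>2"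
            by (simp add: dist_norm diff_diff_add)
          then have "s * (2 * (e \<bullet> (z - y))) \<le> s * (s * (norm e)\<^sup>2)"
            by (simp add: power2_norm_eq_inner inner_diff inner_commute algebra_simps)
          then show ?case using elim(2) by simp
        qed
        moreover have "((\<lambda>s. s * (norm e)\<^sup>2) \<longlongrightarrow> 0 * (norm e)\<^sup>2) (at_right 0)"
          by (intro tendsto_intros)
        ultimately have "2 * (e \<bullet> (z - y)) \<le> 0 * (norm e)\<^sup>2"
          by (intro tendsto_lowerbound) auto
        then show ?thesis by simp
      qed
      then have "e \<bullet> d \<le> 0" if "e \<in> T J" "L e = 0" for e
        using that n by (simp add: d_def divide_simps)
      ultimately have "d \<in> C J" using n by (auto simp: C_def d_def n_def)
      then have "\<mu> \<le> norm (L d)" using m(2) \<mu>(2)[of J] by (force simp: J_def)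
      also have "\<dots> = norm (L z - c) / n" using n y by (simp add: d_def L.scaleR L.diff)
      finally show ?thesis using n \<mu>(1) by (simp add: field_simps n_def)
    qed (use y in simp)
    with y show "\<exists>y\<in>Q. L y = c \<and> norm (z - y) \<le> 1 / \<mu> * norm (L z - c)" by blast
  qed
qed

lemma polyhedron_fst_vimage:
  fixes C :: "'a::euclidean_space set"
  assumes "polyhedron C"
  shows "polyhedron {z :: 'a \<times> 'b::euclidean_space. fst z \<in> C}"
proof -
  obtain F where F: "finite F" "C = \<Inter>F" "\<forall>h\<in>F. \<exists>a b. a \<noteq> 0 \<and> h = {x. a \<bullet> x \<le> b}"
    using assms unfolding polyhedron_def by blast
  have "polyhedron (fst -` h :: ('a \<times> 'b) set)" if h: "h \<in> F" for h
  proof -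
    obtain a b where "h = {x. a \<bullet> x \<le> b}" using F h by blast
    then have "fst -` h = {z :: 'a \<times> 'b. (a, 0) \<bullet> z \<le> b}" by (auto simp: inner_prod_def)
    then show ?thesis by (simp add: polyhedron_halfspace_le)
  qed
  then have "polyhedron (\<Inter>h\<in>F. fst -` h :: ('a \<times> 'b) set)" using F(1) by auto
  moreover have "{z :: 'a \<times> 'b. fst z \<in> C} = (\<Inter>h\<in>F. fst -` h)" using F(2) by auto
  ultimately show ?thesis by simp
qed

text \<open>On an affine piece \<open>C\<close> of the domain and a polyhedral piece
  \<open>K\<close> of the graph the system is linear over a polyhedron. Either the pair of pieces is
  invisible near the reference point, by closedness, or its unperturbed system is consistent and
  Hoffman's bound applies. Finitely many pairs remain to be combined.\<close>

lemma calm_polyhedral: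
  fixes G :: "'a::euclidean_space \<Rightarrow> 'a"
  assumes "piecewise_affine_on E G" "polyhedral_multifunction \<Phi>" "xbar \<in> E" "- G xbar \<in> \<Phi> xbar"
  shows "calm_at (\<lambda>p. {x\<in>E. (x, p - G x) \<in> gph \<Phi>}) 0 xbar"
proof -
  obtain \<C> where \<C>: "finite \<C>" "E = \<Union>\<C>" "\<And>C. C \<in> \<C> \<Longrightarrow> polyhedron C"
    "\<And>C. C \<in> \<C> \<Longrightarrow> \<exists>A b. linear A \<and> (\<forall>x\<in>C. G x = A x + b)"
    using assms(1) unfolding piecewise_affine_on_def by blast
  obtain \<K> where \<K>: "finite \<K>" "gph \<Phi> = \<Union>\<K>" "\<And>K. K \<in> \<K> \<Longrightarrow> polyhedron K"
    using assms(2) unfolding polyhedral_multifunction_def by blast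
  let ?S = "\<lambda>p. {x\<in>E. (x, p - G x) \<in> gph \<Phi>}"
  have "\<exists>\<kappa>\<ge>0. \<exists>\<delta>>0. \<forall>x p. x \<in> C \<and> (x, p - G x) \<in> K \<and> norm p < \<delta> \<and> norm (x - xbar) < \<delta>
      \<longrightarrow> (\<exists>y\<in>?S 0. norm (x - y) \<le> \<kappa> * norm p)" if CK: "C \<in> \<C>" "K \<in> \<K>" for C K
  proof -
    obtain A b where A: "linear A" "\<forall>x\<in>C. G x = A x + b" using \<C>(4) CK(1) by blast
    interpret A: linear A by fact
    \<comment> \<open>\<open>W\<close> collects the \<open>(x, p)\<close> that solve the perturbed
      system within \<open>C\<close> and \<open>K\<close>. Being closed, it contains
      \<open>(xbar, 0)\<close> or misses a neighborhood of it; in the latter case the estimate is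
      vacuous and \<open>\<kappa> = 0\<close> serves.\<close>
    define W where "W = {w. fst w \<in> C} \<inter> (\<lambda>w. (fst w, snd w - A (fst w) - b)) -` K"
    have cA: "continuous_on UNIV (\<lambda>w::'a\<times>'a. A (fst w))"
      using linear_conv_bounded_linear[THEN iffD1, OF A(1)]
      by (intro bounded_linear.continuous_on[of A] continuous_intros)
    have "closed W" unfolding W_def
      using CK \<C>(3) \<K>(3) cA
      by (intro closed_Int polyhedron_imp_closed polyhedron_fst_vimage continuous_closed_vimage)
         (auto intro!: continuous_intros simp: continuous_on_eq_continuous_at)
    show ?thesis
    proof (cases "(xbar, 0) \<in> W")
      case False
      with \<open>closed W\<close> obtain r where r: "r > 0" "ball (xbar, 0) r \<inter> W = {}"
        by (metis open_Compl Compl_iff disjoint_eq_subset_Compl openE inf_commute)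
      have "\<not> (x \<in> C \<and> (x, p - G x) \<in> K)" if "norm p < r/2" "norm (x - xbar) < r/2" for x p
      proof
        assume "x \<in> C \<and> (x, p - G x) \<in> K"
        then have "(x, p) \<in> W" using A by (auto simp: W_def algebra_simps)
        moreover have "dist (xbar, 0) (x, p) < r"
          using that norm_Pair_le[of "xbar - x" "-p"] by (simp add: dist_norm norm_minus_commute)
        ultimately show False using r by auto
      qed
      then show ?thesis using r(1) by (intro exI[of _ 0] conjI exI[of _ "r/2"]) auto
    next
      case True
      \<comment> \<open>For \<open>x \<in> C\<close> the quantity \<open>L (x, v) + b\<close> is the
        residual \<open>v + G x\<close>, which is \<open>p\<close> at \<open>v = p - G x\<close>.
        That \<open>(xbar, 0)\<close> lies in \<open>W\<close> is the consistency of
        \<open>L z = - b\<close> on \<open>Q\<close>.\<close>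
      define Q where "Q = K \<inter> {z. fst z \<in> C}"
      define L where "L z = snd z + A (fst z)" for z :: "'a \<times> 'a"
      have "polyhedron Q" unfolding Q_def using CK \<C>(3) \<K>(3) by (intro polyhedron_Int polyhedron_fst_vimage) auto
      moreover have "linear L" unfolding L_def by (rule linearI) (auto simp: A.add A.scaleR algebra_simps)
      moreover have "(xbar, - A xbar - b) \<in> Q" "L (xbar, - A xbar - b) = - b"
        using True by (auto simp: W_def Q_def L_def)
      ultimately obtain \<kappa> where \<kappa>: "\<kappa> \<ge> 0"
          "\<And>z. z \<in> Q \<Longrightarrow> \<exists>y\<in>Q. L y = - b \<and> norm (z - y) \<le> \<kappa> * norm (L z - - b)"
        using hoffman_error_bound[of Q L "(xbar, - A xbar - b)" "-b"] by blast
      have "\<exists>y\<in>?S 0. norm (x - y) \<le> \<kappa> * norm p" if x: "x \<in> C" "(x, p - G x) \<in> K" for x p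
      proof -
        have "(x, p - G x) \<in> Q" using x by (simp add: Q_def)
        then obtain y where y: "y \<in> Q" "L y = - b" "norm ((x, p - G x) - y) \<le> \<kappa> * norm (L (x, p - G x) - - b)"
          using \<kappa>(2) by blast
        have "L (x, p - G x) - - b = p" using A x by (simp add: L_def)
        moreover have "norm (x - fst y) \<le> norm ((x, p - G x) - y)"
          using norm_fst_le[of "x - fst y" "p - G x - snd y"] by (cases y) simp
        ultimately have "norm (x - fst y) \<le> \<kappa> * norm p" using y by simp
        moreover have "fst y \<in> ?S 0"
        proof -
          have "fst y \<in> C" "y \<in> K" using y by (auto simp: Q_def)
          moreover have "snd y = - G (fst y)"
            using y(2) A(2) \<open>fst y \<in> C\<close> by (simp add: L_def eq_neg_iff_add_eq_0 algebra_simps)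
          ultimately show ?thesis using \<C>(2) \<K>(2) CK by (cases y) auto
        qed
        ultimately show ?thesis by blast
      qed
      \<comment> \<open>Hoffman's bound is global on \<open>Q\<close>, so the radius 1 is
        arbitrary.\<close>
      then show ?thesis using \<kappa>(1) by (intro exI[of _ \<kappa>] conjI exI[of _ 1]) auto
    qed
  qed
  moreover define P where "P q \<kappa> \<delta> \<longleftrightarrow> \<kappa> \<ge> 0 \<and> \<delta> > 0 \<and> (\<forall>x p. x \<in> fst q \<and> (x, p - G x) \<in> snd q \<and>
      norm p < \<delta> \<and> norm (x - xbar) < \<delta> \<longrightarrow> (\<exists>y\<in>?S 0. norm (x - y) \<le> \<kappa> * norm p))" for q \<kappa> \<delta>
  ultimately have "\<forall>q\<in>\<C> \<times> \<K>. \<exists>\<kappa> \<delta>. P q \<kappa> \<delta>" by (simp add: Ball_def)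
  then obtain k d where P: "\<And>q. q \<in> \<C> \<times> \<K> \<Longrightarrow> P q (k q) (d q)" by metis
  have kd: "k q \<ge> 0" "d q > 0" if "q \<in> \<C> \<times> \<K>" for q
    using P[OF that] unfolding P_def by blast+
  have sol: "\<exists>y\<in>?S 0. norm (x - y) \<le> k (C, K) * norm p" if "(C, K) \<in> \<C> \<times> \<K>" "x \<in> C" "(x, p - G x) \<in> K"
      "norm p < d (C, K)" "norm (x - xbar) < d (C, K)" for C K x p
    using P[OF that(1)] that(2-) unfolding P_def fst_conv snd_conv by blast
  have fin: "finite (\<C> \<times> \<K>)" using \<C>(1) \<K>(1) by simp
  show ?thesis
  \<comment> \<open>The sum dominates each single modulus. Inserting 1 makes the argument of
    \<open>Min\<close> visibly nonempty.\<close>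
  proof (rule calm_atI[where \<kappa> = "sum k (\<C> \<times> \<K>)" and \<delta> = "Min (insert 1 (d ` (\<C> \<times> \<K>)))"])
    show "xbar \<in> ?S 0" using assms by (simp add: gph_def)
    show "sum k (\<C> \<times> \<K>) \<ge> 0" using kd by (intro sum_nonneg)
    show "Min (insert 1 (d ` (\<C> \<times> \<K>))) > 0" using kd(2) fin by (subst Min_gr_iff) auto
    fix p x assume px: "norm p < Min (insert 1 (d ` (\<C> \<times> \<K>)))" "norm (x - xbar) < Min (insert 1 (d ` (\<C> \<times> \<K>)))"
      and x: "x \<in> ?S p"
    obtain C K where CK: "C \<in> \<C>" "x \<in> C" "K \<in> \<K>" "(x, p - G x) \<in> K" using x \<C>(2) \<K>(2) by auto
    then have q: "(C, K) \<in> \<C> \<times> \<K>" by simp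
    have "norm p < d (C, K)" "norm (x - xbar) < d (C, K)" using px fin q by auto
    then obtain y where y: "y \<in> ?S 0" "norm (x - y) \<le> k (C, K) * norm p" using sol[OF q CK(2,4)] by blast
    have "k (C, K) \<le> sum k (\<C> \<times> \<K>)" using fin q kd(1) by (intro member_le_sum) auto
    then have "norm (x - y) \<le> sum k (\<C> \<times> \<K>) * norm p" using y(2) by (meson mult_right_mono norm_ge_zero order_trans)
    with y show "\<exists>y\<in>?S 0. norm (x - y) \<le> sum k (\<C> \<times> \<K>) * norm p" by blast
  qed
qed

section \<open>Approximate normals and approximate minimizers\<close>

lemma mem_cball_norm: "z \<in> cball a r \<longleftrightarrow> norm (z - a) \<le> r"
  for a :: "'a::real_normed_vector"
  by (simp add: dist_norm norm_minus_commute)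

text \<open>Later minimizations run over balls around moving points. Halving the radius keeps all
  these balls inside the one in which \<open>D\<close> is known to be closed.\<close>

lemma closed_near_cball:
  assumes "closed_near D z"
  obtains r where "r > 0" "\<And>y s. \<lbrakk>dist z y \<le> r; s \<le> r\<rbrakk> \<Longrightarrow> closed (D \<inter> cball y s)"
proof -
  obtain r where r: "r > 0" "closed (D \<inter> cball z r)" using assms unfolding closed_near_def by blast
  show ?thesis
  proof (rule that[of "r/2"])
    fix y s assume "dist z y \<le> r/2" "s \<le> r/2"
    then have "cball y s \<subseteq> cball z r"
      by (smt (verit) dist_triangle field_sum_of_halves mem_cball subsetI)
    then have "D \<inter> cball y s = (D \<inter> cball z r) \<inter> cball y s" by auto
    then show "closed (D \<inter> cball y s)" using r(2) by (metis closed_Int closed_cball)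
  qed (use r in simp)
qed

text \<open>Project \<open>z0 + t w\<close> onto \<open>D\<close> for small \<open>t\<close>: the projection is within \<open>2 \<epsilon> t\<close> of \<open>z0\<close>, and the
  normalized residual is a proximal normal there.\<close>

lemma regular_normal_near:
  fixes D :: "'a::euclidean_space set"
  assumes "z0 \<in> D" "r > 0" "closed (D \<inter> cball z0 r)" "\<epsilon> \<ge> 0" "\<delta> > 0"
    and w: "\<And>z. z \<in> D \<inter> cball z0 r \<Longrightarrow> w \<bullet> (z - z0) \<le> \<epsilon> * norm (z - z0)"
  obtains z w' where "z \<in> D" "norm (z - z0) \<le> \<delta>" "norm (w' - w) \<le> 2 * \<epsilon>" "w' \<in> regular_normal_cone D z"
proof -
  \<comment> \<open>This makes \<open>2 * \<epsilon> * t\<close> at most \<open>r/2\<close> and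
    \<open>\<delta>\<close>: the projection stays in the inner half of the ball, so all points of
    \<open>D\<close> close to it are still competitors. The summand 1 admits
    \<open>\<epsilon> = 0\<close>.\<close>
  define t where "t = min (r/2) \<delta> / (2 * \<epsilon> + 1)"
  have t: "t > 0" using assms by (simp add: t_def)
  have "2 * \<epsilon> * t \<le> (2 * \<epsilon> + 1) * t" using t by simp
  also have "\<dots> = min (r/2) \<delta>" using assms(4) by (simp add: t_def)
  finally have te: "2 * \<epsilon> * t \<le> min (r/2) \<delta>" .
  have "D \<inter> cball z0 r \<noteq> {}" using assms by force
  then obtain z where z: "z \<in> D \<inter> cball z0 r"
      and zmin: "\<And>y. y \<in> D \<inter> cball z0 r \<Longrightarrow> dist (z0 + t *\<^sub>R w) z \<le> dist (z0 + t *\<^sub>R w) y"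
    using closest_point_exists[OF assms(3)] by blast
  \<comment> \<open>Comparing the projection with \<open>z0\<close> bounds the square of
    \<open>norm (z - z0)\<close> by \<open>2 * t * (w \<bullet> (z - z0))\<close>; the hypothesis on
    \<open>w\<close> then lets one factor cancel.\<close>
  have "norm (t *\<^sub>R w - (z - z0)) \<le> norm (t *\<^sub>R w)"
    using zmin[of z0] assms by (simp add: dist_norm algebra_simps)
  then have "(norm (t *\<^sub>R w - (z - z0)))\<^sup>2 \<le> (norm (t *\<^sub>R w))\<^sup>2" by simp
  then have "(norm (z - z0))\<^sup>2 \<le> 2 * t * (w \<bullet> (z - z0))"
    by (simp only: power2_norm_eq_inner inner_diff inner_commute; simp add: inner_commute algebra_simps)
  also have "\<dots> \<le> 2 * t * (\<epsilon> * norm (z - z0))" using w[OF z] t by simp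
  finally have "norm (z - z0) * norm (z - z0) \<le> (2 * \<epsilon> * t) * norm (z - z0)"
    by (simp add: power2_eq_square algebra_simps)
  then have nz: "norm (z - z0) \<le> 2 * \<epsilon> * t"
    using assms(4) t by (cases "z = z0") auto
  define w' where "w' = (1/t) *\<^sub>R (z0 + t *\<^sub>R w - z)"
  have "w' - w = (1/t) *\<^sub>R (z0 - z)" using t by (simp add: w'_def algebra_simps)
  then have "norm (w' - w) = norm (z - z0) / t" using t by (simp add: norm_minus_commute)
  then have nw: "norm (w' - w) \<le> 2 * \<epsilon>" using nz t by (simp add: divide_le_eq)
  \<comment> \<open>The same expansion, now against arbitrary points of \<open>D\<close> near
    \<open>z\<close>. The quadratic right-hand side is below \<open>e * norm (y - z)\<close> as soon
    as \<open>norm (y - z) < 2*t*e\<close>, which yields regularity of the normal.\<close>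
  have quad: "w' \<bullet> (y - z) \<le> (norm (y - z))\<^sup>2 / (2 * t)" if y: "y \<in> D" "norm (y - z) < r/2" for y
  proof -
    have "dist z0 y \<le> dist z0 z + dist z y" by (rule dist_triangle)
    also have "\<dots> \<le> r" using y nz te by (simp add: dist_norm norm_minus_commute)
    finally have "(dist (z0 + t *\<^sub>R w) z)\<^sup>2 \<le> (dist (z0 + t *\<^sub>R w) y)\<^sup>2"
      using y by (intro power_mono zmin) auto
    moreover have "dist (z0 + t *\<^sub>R w) z = norm (t *\<^sub>R w')" using t by (simp add: dist_norm w'_def)
    moreover have "dist (z0 + t *\<^sub>R w) y = norm (t *\<^sub>R w' - (y - z))" using t by (simp add: dist_norm w'_def)
    ultimately have "(norm (t *\<^sub>R w'))\<^sup>2 \<le> (norm (t *\<^sub>R w' - (y - z)))\<^sup>2" by simp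
    then have "2 * t * (w' \<bullet> (y - z)) \<le> (norm (y - z))\<^sup>2"
      by (simp only: power2_norm_eq_inner inner_diff inner_commute; simp add: inner_commute algebra_simps)
    then show ?thesis using t by (simp add: field_simps)
  qed
  have "eventually (\<lambda>y. w' \<bullet> (y - z) \<le> e * norm (y - z)) (at z within D)" if e: "e > 0" for e
    unfolding eventually_at
  proof (intro exI[of _ "min (r/2) (2*t*e)"] conjI ballI impI)
    fix y assume y: "y \<in> D" "y \<noteq> z \<and> dist y z < min (r/2) (2*t*e)"
    have "w' \<bullet> (y - z) \<le> norm (y - z) * norm (y - z) / (2 * t)"
      using quad[of y] y by (simp add: dist_norm power2_eq_square)
    also have "\<dots> \<le> (2*t*e) * norm (y - z) / (2 * t)"
      using y t by (intro divide_right_mono mult_right_mono) (auto simp: dist_norm)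
    finally show "w' \<bullet> (y - z) \<le> e * norm (y - z)" using t by simp
  qed (use assms t e in simp)
  then have "w' \<in> regular_normal_cone D z" using z by (simp add: regular_normal_cone_def)
  then show ?thesis using z nz te nw by (intro that[of z w']) auto
qed

text \<open>A point where calmness fails is moved to a minimizer, over the graph, of the residual plus
  \<open>\<epsilon>\<close> times the distance to that point (Ekeland's principle, here by compactness). The minimizer is
  not a solution because the nearest solution is too far away.\<close>

lemma not_calm_imp_local_minimizer:
  fixes G :: "'a::euclidean_space \<Rightarrow> 'a"
  assumes E: "open E" "xbar \<in> E" "continuous_on E G"
    and D: "closed_near D (xbar, - G xbar)" "(xbar, - G xbar) \<in> D"
    and ncalm: "\<not> calm_at (\<lambda>p. {x\<in>E. (x, p - G x) \<in> D}) 0 xbar"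
    and \<epsilon>: "\<epsilon> > 0"
  obtains x v \<rho> where "x \<in> E" "(x, v) \<in> D" "0 < norm (x - xbar)" "norm (x - xbar) < \<epsilon>"
    "v + G x \<noteq> 0" "norm (v + G x) \<le> \<epsilon> * norm (x - xbar)" "\<rho> > 0"
    "\<And>x' v'. \<lbrakk>(x', v') \<in> D; norm ((x', v') - (x, v)) \<le> \<rho>\<rbrakk> \<Longrightarrow>
       norm (v + G x) \<le> norm (v' + G x') + \<epsilon> * norm ((x', v') - (x, v))"
proof -
  let ?S = "\<lambda>p. {x\<in>E. (x, p - G x) \<in> D}"
  let ?z = "(xbar, - G xbar)"
  obtain r1 where r1: "r1 > 0" "\<And>y s. \<lbrakk>dist ?z y \<le> r1; s \<le> r1\<rbrakk> \<Longrightarrow> closed (D \<inter> cball y s)"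
    by (rule closed_near_cball[OF D(1)]) (rule that)
  obtain r2 where r2: "r2 > 0" "cball xbar r2 \<subseteq> E" using E open_contains_cball by blast
  define r where "r = min r1 r2"
  define K where "K = D \<inter> cball ?z r"
  have r: "r > 0" "r \<le> r1" "r \<le> r2" using r1 r2 by (auto simp: r_def)
  have "closed K" unfolding K_def by (rule r1(2)) (use r r1 in auto)
  then have K: "compact K" unfolding K_def by (simp add: compact_eq_bounded_closed bounded_Int)
  have KE: "fst z \<in> E" if "z \<in> K" for z
  proof -
    have "dist xbar (fst z) \<le> dist ?z z" using dist_fst_le[of ?z z] by simp
    then have "fst z \<in> cball xbar r2" using that r by (auto simp: K_def)
    then show ?thesis using r2 by auto
  qed
  have contK: "continuous_on K (\<lambda>z. norm (snd z + G (fst z)) + \<epsilon> * norm (z - q))" for q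
    by (intro continuous_intros continuous_on_compose2[OF E(3)]) (use KE in auto)
  have "isCont G xbar" using E by (simp add: continuous_on_eq_continuous_at)
  then obtain d where d: "d > 0" "\<And>x. dist x xbar < d \<Longrightarrow> dist (G x) (G xbar) < r/8"
    using r(1) unfolding continuous_at_eps_delta by (metis divide_pos_pos zero_less_numeral)
  \<comment> \<open>The bounds by \<open>d\<close> and \<open>r/8\<close> put the starting point
    \<open>q\<close> in the inner half of the ball; \<open>\<epsilon> * r / 4\<close> gives
    \<open>norm p / \<epsilon> \<le> r/4\<close>, leaving a margin \<open>r/4\<close> around the
    minimizer; the last two bounds add up to \<open>norm (x - xbar) < \<epsilon>\<close>.\<close>
  define \<delta> where "\<delta> = min (min d (r/8)) (min (\<epsilon> * r / 4) (min (\<epsilon>/2) (\<epsilon> * \<epsilon> / 2)))"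
  have \<delta>: "\<delta> > 0" "\<delta> \<le> d" "\<delta> \<le> r/8" "\<delta> \<le> \<epsilon> * r / 4" "\<delta> \<le> \<epsilon>/2" "\<delta> \<le> \<epsilon> * \<epsilon> / 2"
    using d r \<epsilon> by (auto simp: \<delta>_def)
  have xS: "xbar \<in> ?S 0" using E D by simp
  \<comment> \<open>Calmness is negated with modulus \<open>2/\<epsilon>\<close> because the
    minimizer will lie within \<open>norm p / \<epsilon>\<close> of \<open>y\<close>: that is half
    the distance guaranteed between \<open>y\<close> and every solution.\<close>
  have "\<exists>p y. norm p < \<delta> \<and> norm (y - xbar) < \<delta> \<and> y \<in> ?S p \<and> (\<forall>x\<in>?S 0. norm (y - x) > 2/\<epsilon> * norm p)"
  proof (rule ccontr)
    assume *: "\<not> ?thesis"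
    have "2/\<epsilon> \<ge> 0" using \<epsilon> by simp
    moreover have "\<exists>x\<in>?S 0. norm (y - x) \<le> 2/\<epsilon> * norm p"
      if "norm p < \<delta>" "norm (y - xbar) < \<delta>" "y \<in> ?S p" for p y
      using * that by (meson not_less)
    ultimately have "calm_at ?S 0 xbar" by (intro calm_atI[of _ _ "2/\<epsilon>" \<delta>] xS \<delta>(1))
    with ncalm show False by simp
  qed
  then obtain p y where p: "norm p < \<delta>" and y: "norm (y - xbar) < \<delta>" "y \<in> E" "(y, p - G y) \<in> D"
      and far: "\<And>x. x \<in> ?S 0 \<Longrightarrow> norm (y - x) > 2/\<epsilon> * norm p" by auto
  define q where "q = (y, p - G y)"
  have "norm (q - ?z) \<le> norm (y - xbar) + norm (p - (G y - G xbar))"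
    using norm_Pair_le[of "y - xbar" "p - (G y - G xbar)"] by (simp add: q_def algebra_simps)
  also have "norm (p - (G y - G xbar)) \<le> norm p + norm (G y - G xbar)" by (rule norm_triangle_ineq4)
  also have "norm (G y - G xbar) < r/8" using d(2)[of y] y \<delta> by (simp add: dist_norm)
  finally have q: "norm (q - ?z) < r/2" using y p \<delta> r by linarith
  have qK: "q \<in> K" using q y r by (simp add: K_def mem_cball_norm q_def del: mem_cball)
  obtain z where z: "z \<in> K" and zmin: "\<And>z'. z' \<in> K \<Longrightarrow>
      norm (snd z + G (fst z)) + \<epsilon> * norm (z - q) \<le> norm (snd z' + G (fst z')) + \<epsilon> * norm (z' - q)"
    using continuous_attains_inf[OF K _ contK[of q]] qK by blast
  have zp: "norm (snd z + G (fst z)) + \<epsilon> * norm (z - q) \<le> norm p"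
    using zmin[OF qK] by (simp add: q_def)
  then have zp2: "\<epsilon> * norm (z - q) \<le> norm p" using norm_ge_zero[of "snd z + G (fst z)"] by linarith
  then have zq: "norm (z - q) \<le> norm p / \<epsilon>" using \<epsilon> by (simp add: field_simps)
  have zn: "norm (snd z + G (fst z)) \<le> norm p"
  proof -
    have "\<epsilon> * norm (z - q) \<ge> 0" using \<epsilon> by simp
    then show ?thesis using zp by linarith
  qed
  have fz: "norm (y - fst z) \<le> norm p / \<epsilon>"
    using norm_fst_le[of "fst z - y" "snd z - (p - G y)"] zq by (cases z) (simp add: q_def norm_minus_commute)
  have "norm p / \<epsilon> \<le> r/4" using p \<delta>(4) \<epsilon> by (simp add: field_simps)
  then have zin: "norm (z - ?z) < 3*r/4"
    using zq q dist_triangle[of z ?z q, unfolded dist_norm] by linarith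
  have pe: "norm p / \<epsilon> \<ge> 0" using \<epsilon> by simp
  show ?thesis
  proof (rule that[of "fst z" "snd z" "r/4"])
    show "fst z \<in> E" using KE z by simp
    show "(fst z, snd z) \<in> D" using z by (simp add: K_def)
    \<comment> \<open>The gap also applies to the solution \<open>xbar\<close>. So the minimizer is
      farther than \<open>norm p / \<epsilon>\<close> from \<open>xbar\<close> while its residual is
      at most \<open>norm p\<close>; hence the residual is small relative to the distance.\<close>
    have "2 * (norm p / \<epsilon>) < norm (y - xbar)" using far[OF xS] by simp
    also have "\<dots> \<le> norm (y - fst z) + norm (fst z - xbar)"
      using dist_triangle[of y xbar "fst z", unfolded dist_norm] by simp
    finally have g: "norm p / \<epsilon> < norm (fst z - xbar)" using fz by linarith
    then show "0 < norm (fst z - xbar)" using pe by linarith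
    have "norm p < \<epsilon> * norm (fst z - xbar)" using g \<epsilon> by (simp add: field_simps)
    then show "norm (snd z + G (fst z)) \<le> \<epsilon> * norm (fst z - xbar)" using zn by linarith
    have "norm p / \<epsilon> < \<epsilon>/2" using p \<delta>(6) \<epsilon> by (simp add: field_simps)
    then show "norm (fst z - xbar) < \<epsilon>"
      using fz y(1) \<delta>(5) dist_triangle[of "fst z" xbar y, unfolded dist_norm] norm_minus_commute[of y "fst z"]
      by linarith
    show "snd z + G (fst z) \<noteq> 0"
    proof
      assume "snd z + G (fst z) = 0"
      then have "z = (fst z, 0 - G (fst z))" by (metis add_diff_cancel_right' prod.collapse)
      then have "fst z \<in> ?S 0" using z KE by (auto simp: K_def)
      from far[OF this] fz pe show False by simp
    qed
    show "r/4 > 0" using r by simp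
    fix x' v' assume xv: "(x', v') \<in> D" "norm ((x', v') - (fst z, snd z)) \<le> r/4"
    have "norm ((x', v') - ?z) \<le> r"
      using dist_triangle[of "(x', v')" ?z z, unfolded dist_norm] xv zin by simp
    then have "(x', v') \<in> K" using xv by (simp add: K_def mem_cball_norm del: mem_cball)
    from zmin[OF this] have "norm (snd z + G (fst z)) + \<epsilon> * norm (z - q) \<le> norm (v' + G x') + \<epsilon> * norm ((x', v') - q)"
      by simp
    \<comment> \<open>The triangle inequality recentres the penalty from \<open>q\<close> to the
      minimizer without changing its constant.\<close>
    moreover have "\<epsilon> * norm ((x', v') - q) \<le> \<epsilon> * (norm ((x', v') - z) + norm (z - q))"
      using \<epsilon> dist_triangle[of "(x', v')" q z, unfolded dist_norm] by simp
    ultimately show "norm (snd z + G (fst z)) \<le> norm (v' + G x') + \<epsilon> * norm ((x', v') - (fst z, snd z))"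
      by (simp add: algebra_simps)
  qed
qed

text \<open>A fuzzy sum rule. The variable of \<open>h\<close> is decoupled as \<open>u\<close> and coupled again by the penalty
  \<open>m \<parallel>x - u\<parallel>\<^sup>2\<close>, which makes \<open>2 m (x - u)\<close> a proximal subgradient of \<open>h\<close> at the minimizer.\<close>

lemma fuzzy_sum_rule:
  fixes D :: "('a::euclidean_space \<times> 'a) set"
  assumes z0: "(x0, v0) \<in> D" and r: "r > 0" "closed (D \<inter> cball (x0, v0) r)"
    and h: "L-lipschitz_on (cball x0 r) h"
    and \<epsilon>: "\<epsilon> > 0" and \<delta>: "\<delta> > 0"
    and min0: "\<And>x v. (x, v) \<in> D \<inter> cball (x0, v0) r \<Longrightarrow>
       \<eta> \<bullet> v0 + h x0 \<le> \<eta> \<bullet> v + h x + \<epsilon> * norm ((x, v) - (x0, v0))"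
  obtains u \<zeta> z w where "norm (u - x0) \<le> \<delta>" "norm \<zeta> \<le> 2 * L" "\<zeta> \<in> prox_subdiff (\<lambda>x. ereal (h x)) u"
    "z \<in> D" "norm (z - (x0, v0)) \<le> \<delta>" "w \<in> regular_normal_cone D z" "norm (w - (- \<zeta>, - \<eta>)) \<le> 6 * \<epsilon>"
proof -
  let ?z = "(x0, v0)"
  have L: "L \<ge> 0" using h by (rule lipschitz_on_nonneg)
  define \<delta>' where "\<delta>' = min \<delta> r / 4"
  have \<delta>': "\<delta>' > 0" "\<delta>' \<le> \<delta>/4" "\<delta>' \<le> r/4" using \<delta> r by (auto simp: \<delta>'_def)
  \<comment> \<open>Of the three summands, the first will force \<open>(x, v)\<close> within
    \<open>\<delta>'\<close> of \<open>(x0, v0)\<close>, the second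
    \<open>norm (x - u) \<le> \<delta>'\<close>, and the third secures \<open>m > 0\<close>.\<close>
  define m where "m = (L\<^sup>2 / \<epsilon> + L + 1) / \<delta>'"
  have m: "m > 0" using \<delta>' L \<epsilon> by (auto simp: m_def intro!: divide_pos_pos add_nonneg_pos)
  have "m * \<delta>' = L\<^sup>2 / \<epsilon> + L + 1" using \<delta>' by (simp add: m_def)
  then have m1: "L \<le> m * \<delta>'" "L\<^sup>2 / \<epsilon> \<le> m * \<delta>'" using L \<epsilon> by auto
  define K where "K = D \<inter> cball ?z r"
  \<comment> \<open>The weight is twice that of \<open>min0\<close>: one \<open>\<epsilon>\<close>
    compensates the error allowed there, the other pulls the minimizer towards
    \<open>(x0, v0)\<close>.\<close>
  define \<Psi> where "\<Psi> q = \<eta> \<bullet> snd (fst q) + h (snd q) + 2 * \<epsilon> * norm (fst q - ?z) + m * (norm (fst (fst q) - snd q))\<^sup>2"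
    for q :: "('a \<times> 'a) \<times> 'a"
  have K: "compact K" using r unfolding K_def by (simp add: compact_eq_bounded_closed bounded_Int)
  have Kc: "fst z \<in> cball x0 r" if "z \<in> K" for z
    using that dist_fst_le[of ?z z] by (auto simp: K_def)
  have "continuous_on (K \<times> cball x0 r) \<Psi>"
    unfolding \<Psi>_def
    by (intro continuous_intros continuous_on_compose2[OF lipschitz_on_continuous_on[OF h]]) auto
  moreover have "compact (K \<times> cball x0 r)" using K by (intro compact_Times) auto
  moreover have in0: "(?z, x0) \<in> K \<times> cball x0 r" using z0 r by (simp add: K_def)
  ultimately obtain q where q: "q \<in> K \<times> cball x0 r" "\<And>q'. q' \<in> K \<times> cball x0 r \<Longrightarrow> \<Psi> q \<le> \<Psi> q'"
    using continuous_attains_inf[of "K \<times> cball x0 r" \<Psi>] by blast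
  obtain x v u where quv: "q = ((x, v), u)" by (metis prod.collapse)
  define s where "s = norm (x - u)"
  define \<zeta> where "\<zeta> = (2 * m) *\<^sub>R (x - u)"
  have zK: "(x, v) \<in> K" and u: "u \<in> cball x0 r" using q quv by auto
  have xr: "x \<in> cball x0 r" using Kc[OF zK] by simp
  have hL: "\<bar>h a - h b\<bar> \<le> L * norm (a - b)" if "a \<in> cball x0 r" "b \<in> cball x0 r" for a b
    using lipschitz_onD[OF h that] by (simp add: dist_norm)
  \<comment> \<open>Moving \<open>u\<close> to \<open>x\<close> removes the coupling penalty and
    changes \<open>h\<close> by at most \<open>L * s\<close>. The outcome
    \<open>m * s \<le> L\<close> controls both the distance \<open>s\<close> and the norm of
    \<open>\<zeta>\<close>.\<close>
  have "\<Psi> q \<le> \<Psi> ((x, v), x)" using zK xr by (intro q) auto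
  then have "m * s\<^sup>2 \<le> h x - h u" by (simp add: \<Psi>_def quv s_def)
  also have "\<dots> \<le> L * s" using hL[OF xr u] by (simp add: s_def)
  finally have "s * (m * s) \<le> s * L" by (simp add: power2_eq_square algebra_simps)
  then have ms: "m * s \<le> L" using L by (cases "s = 0") (auto simp: s_def)
  have s0: "s \<ge> 0" by (simp add: s_def)
  have "m * s \<le> m * \<delta>'" using ms m1 by linarith
  then have s\<delta>: "s \<le> \<delta>'" using m by simp
  have "\<Psi> q \<le> \<Psi> (?z, x0)" using in0 by (rule q)
  then have "\<eta> \<bullet> v + h u + 2 * \<epsilon> * norm ((x, v) - ?z) + m * s\<^sup>2 \<le> \<eta> \<bullet> v0 + h x0"
    by (simp add: \<Psi>_def quv s_def)
  moreover have "\<eta> \<bullet> v0 + h x0 \<le> \<eta> \<bullet> v + h x + \<epsilon> * norm ((x, v) - ?z)"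
    using min0[of x v] zK by (simp add: K_def)
  moreover have "h x - h u \<le> L * s" using hL[OF xr u] by (simp add: s_def)
  moreover have "m * s\<^sup>2 \<ge> 0" using m by simp
  ultimately have "\<epsilon> * norm ((x, v) - ?z) \<le> L * s" by (simp add: algebra_simps)
  then have "m * (\<epsilon> * norm ((x, v) - ?z)) \<le> m * (L * s)" using m by simp
  also have "\<dots> \<le> L * L" using mult_left_mono[OF ms L] by (simp add: algebra_simps)
  also have "\<dots> \<le> \<epsilon> * (m * \<delta>')" using m1(2) \<epsilon> by (simp add: power2_eq_square field_simps)
  finally have "(m * \<epsilon>) * norm ((x, v) - ?z) \<le> (m * \<epsilon>) * \<delta>'" by (simp add: algebra_simps)
  then have z\<delta>: "norm ((x, v) - ?z) \<le> \<delta>'" using m \<epsilon> by simp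
  then have x\<delta>: "norm (x - x0) \<le> \<delta>'" using norm_fst_le[of "x - x0" "v - v0"] by simp
  have u\<delta>: "norm (u - x0) \<le> 2 * \<delta>'"
    using dist_triangle[of u x0 x, unfolded dist_norm] x\<delta> s\<delta> by (simp add: s_def norm_minus_commute)
  have n\<zeta>: "norm \<zeta> \<le> 2 * L" using ms m by (simp add: \<zeta>_def s_def)
  \<comment> \<open>Only \<open>u\<close> varies here. \<open>\<zeta>\<close> is the negative
    gradient in \<open>u\<close> of the coupling penalty, and its curvature supplies the proximal
    constant \<open>m\<close>.\<close>
  have "h u + (\<zeta> \<bullet> (u' - u) - m * (norm (u' - u))\<^sup>2) \<le> h u'" if "u' \<in> ball u (r/2)" for u'
  proof -
    from that have "norm (u' - u) < r/2" by (simp add: dist_norm norm_minus_commute)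
    then have "norm (u' - x0) \<le> r"
      using dist_triangle[of u' x0 u, unfolded dist_norm] u\<delta> \<delta>' by simp
    then have "\<Psi> q \<le> \<Psi> ((x, v), u')" using zK by (intro q) (auto simp: dist_norm norm_minus_commute)
    then have "h u + m * (norm (x - u))\<^sup>2 \<le> h u' + m * (norm ((x - u) - (u' - u)))\<^sup>2"
      by (simp add: \<Psi>_def quv)
    also have "(norm ((x - u) - (u' - u)))\<^sup>2 = (norm (x - u))\<^sup>2 - 2 * ((x - u) \<bullet> (u' - u)) + (norm (u' - u))\<^sup>2"
      by (simp only: power2_norm_eq_inner inner_diff_left inner_diff_right inner_commute; simp add: inner_commute algebra_simps)
    finally show ?thesis
      by (simp add: \<zeta>_def algebra_simps)
  qed
  then have "\<forall>u'\<in>ball u (r/2). ereal (h u') \<ge> ereal (h u) + ereal (\<zeta> \<bullet> (u' - u) - m * (norm (u' - u))\<^sup>2)"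
    by simp
  moreover have "r/2 > 0" using r by simp
  ultimately have prox: "\<zeta> \<in> prox_subdiff (\<lambda>x. ereal (h x)) u"
    unfolding prox_subdiff_def edom_def using m by fastforce
  \<comment> \<open>Now \<open>u\<close> is fixed and \<open>(x, v)\<close> varies. On this radius
    the quadratic remainder of the coupling penalty costs at most \<open>\<epsilon>\<close> times
    the distance; with the \<open>2 * \<epsilon>\<close> in \<open>\<Psi>\<close> this makes
    \<open>3 * \<epsilon>\<close>, doubled by the projection.\<close>
  define \<rho> where "\<rho> = min (r/2) (\<epsilon>/m)"
  have \<rho>: "\<rho> > 0" "\<rho> \<le> r/2" "\<rho> \<le> \<epsilon>/m" using r(1) \<epsilon> m unfolding \<rho>_def by (simp, linarith, simp)
  have sub: "cball (x, v) \<rho> \<subseteq> cball ?z r"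
  proof
    fix z assume "z \<in> cball (x, v) \<rho>"
    then have "dist (x, v) z \<le> r/2" using \<rho> by simp
    moreover have "dist ?z (x, v) \<le> r/4"
      using z\<delta> \<delta>'(3) unfolding dist_norm norm_minus_commute[of ?z] by linarith
    ultimately show "z \<in> cball ?z r" using dist_triangle[of ?z z "(x, v)"] r by simp
  qed
  obtain z w where zw: "z \<in> D" "norm (z - (x, v)) \<le> \<delta>'" "norm (w - (- \<zeta>, - \<eta>)) \<le> 2 * (3 * \<epsilon>)" "w \<in> regular_normal_cone D z"
  proof (rule regular_normal_near[of "(x, v)" D \<rho> "3 * \<epsilon>" \<delta>' "(- \<zeta>, - \<eta>)"])
    show "(x, v) \<in> D" using zK by (simp add: K_def)
    show "\<rho> > 0" "0 \<le> 3 * \<epsilon>" "\<delta>' > 0" using \<rho> \<epsilon> \<delta>' by auto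
    have "D \<inter> cball (x, v) \<rho> = (D \<inter> cball ?z r) \<inter> cball (x, v) \<rho>" using sub by blast
    then show "closed (D \<inter> cball (x, v) \<rho>)" using r(2) by (metis closed_Int closed_cball)
    fix z' assume z': "z' \<in> D \<inter> cball (x, v) \<rho>"
    obtain x' v' where xv: "z' = (x', v')" by force
    have n\<rho>: "norm (z' - (x, v)) \<le> \<rho>" using z' by (simp add: mem_cball_norm del: mem_cball)
    have nx: "norm (x' - x) \<le> norm (z' - (x, v))" using norm_fst_le[of "x' - x" "v' - v"] by (simp add: xv)
    have "z' \<in> K" using z' sub unfolding K_def by blast
    then have "\<Psi> q \<le> \<Psi> (z', u)" using u by (intro q) auto
    then have "\<eta> \<bullet> v + 2 * \<epsilon> * norm ((x, v) - ?z) + m * (norm (x - u))\<^sup>2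
        \<le> \<eta> \<bullet> v' + 2 * \<epsilon> * norm (z' - ?z) + m * (norm ((x - u) + (x' - x)))\<^sup>2"
      by (simp add: \<Psi>_def quv xv)
    moreover have "m * (norm ((x - u) + (x' - x)))\<^sup>2
        = m * (norm (x - u))\<^sup>2 + 2 * m * ((x - u) \<bullet> (x' - x)) + m * (norm (x' - x))\<^sup>2"
    proof -
      have "(norm (a + b))\<^sup>2 = (norm a)\<^sup>2 + 2 * (a \<bullet> b) + (norm b)\<^sup>2" for a b :: 'a
        by (simp add: power2_norm_eq_inner inner_add inner_commute)
      from this[of "x - u" "x' - x"] show ?thesis by (simp only: distrib_left mult.assoc mult.left_commute)
    qed
    moreover have "2 * \<epsilon> * norm (z' - ?z) \<le> 2 * \<epsilon> * norm ((x, v) - ?z) + 2 * \<epsilon> * norm (z' - (x, v))"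
    proof -
      have "norm (z' - ?z) \<le> norm ((x, v) - ?z) + norm (z' - (x, v))"
        using dist_triangle[of z' ?z "(x, v)", unfolded dist_norm] by linarith
      then have "2 * \<epsilon> * norm (z' - ?z) \<le> 2 * \<epsilon> * (norm ((x, v) - ?z) + norm (z' - (x, v)))"
        using \<epsilon> by simp
      then show ?thesis by (simp add: algebra_simps)
    qed
    moreover have "m * (norm (x' - x))\<^sup>2 \<le> \<epsilon> * norm (z' - (x, v))"
    proof -
      have "m * norm (x' - x) \<le> m * (\<epsilon>/m)" using nx n\<rho> \<rho> m by (intro mult_left_mono) auto
      then have "m * norm (x' - x) \<le> \<epsilon>" using m by simp
      then have "(m * norm (x' - x)) * norm (x' - x) \<le> \<epsilon> * norm (z' - (x, v))"
        using nx \<epsilon> by (intro mult_mono) auto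
      then show ?thesis by (simp add: power2_eq_square algebra_simps)
    qed
    ultimately have "- (\<eta> \<bullet> (v' - v)) - 2 * m * ((x - u) \<bullet> (x' - x)) \<le> 3 * \<epsilon> * norm (z' - (x, v))"
      unfolding inner_diff_right[of \<eta>] by linarith
    then show "(- \<zeta>, - \<eta>) \<bullet> (z' - (x, v)) \<le> 3 * \<epsilon> * norm (z' - (x, v))"
      by (simp add: xv \<zeta>_def)
  qed auto
  have "norm (z - ?z) \<le> \<delta>"
    using dist_triangle[of z ?z "(x, v)", unfolded dist_norm] zw(2) z\<delta> \<delta>' by linarith
  then show ?thesis using zw prox n\<zeta> u\<delta> \<delta>' by (intro that[of u \<zeta> z w]) auto
qed

section \<open>Calmness under the constraint qualifications\<close>

text \<open>The subdifferential in \<open>cq\<close> belongs to one fixed \<open>\<eta>\<close>,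
  while the minimizers produce varying unit residuals. So the limit \<open>\<eta>\<close> is
  extracted first, the mismatch is charged to the error, and the fuzzy sum rule is applied with
  \<open>\<eta>\<close>. The Lipschitz constant bounds the subgradients and so provides their
  limit.\<close>

lemma calm_of_limiting_normals:
  fixes G :: "'a::euclidean_space \<Rightarrow> 'a"
  assumes E: "open E" "xbar \<in> E" "continuous_on E G"
    and D: "closed_near D (xbar, - G xbar)" "(xbar, - G xbar) \<in> D"
    and lip: "lipschitz_around G E xbar"
    and cq: "\<And>\<xi> \<eta>. \<lbrakk>- \<xi> \<in> lim_subdiff (\<lambda>x. ereal (- (G x \<bullet> \<eta>))) xbar;
      (\<xi>, \<eta>) \<in> limiting_normal_cone D (xbar, - G xbar)\<rbrakk> \<Longrightarrow> (\<xi>, \<eta>) = 0"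
  shows "calm_at (\<lambda>p. {x\<in>E. (x, p - G x) \<in> D}) 0 xbar"
proof (rule ccontr)
  assume nc: "\<not> ?thesis"
  let ?z = "(xbar, - G xbar)"
  obtain U L where U: "open U" "xbar \<in> U" "L-lipschitz_on U G"
    using lip unfolding lipschitz_around_def by blast
  have L: "L \<ge> 0" using U(3) by (rule lipschitz_on_nonneg)
  obtain r0 where r0: "r0 > 0" "cball xbar r0 \<subseteq> U" using U open_contains_cball by blast
  obtain r1 where r1: "r1 > 0" "\<And>y s. \<lbrakk>dist ?z y \<le> r1; s \<le> r1\<rbrakk> \<Longrightarrow> closed (D \<inter> cball y s)"
    by (rule closed_near_cball[OF D(1)]) (rule that)
  define e where "e n = inverse (real (Suc n))" for n
  have e: "e n > 0" for n by (simp add: e_def)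
  have e0: "e \<longlonglongrightarrow> 0" unfolding e_def by (rule LIMSEQ_inverse_real_of_nat)
  have "\<exists>x v \<rho>. (x, v) \<in> D \<and> norm (x - xbar) < e n \<and> v + G x \<noteq> 0 \<and> norm (v + G x) \<le> e n * norm (x - xbar) \<and> \<rho> > 0 \<and>
      (\<forall>x' v'. (x', v') \<in> D \<and> norm ((x', v') - (x, v)) \<le> \<rho> \<longrightarrow>
       norm (v + G x) \<le> norm (v' + G x') + e n * norm ((x', v') - (x, v)))" for n
    by (rule not_calm_imp_local_minimizer[OF E D nc e[of n]]) blast
  then obtain x v \<rho> where xv: "\<And>n. (x n, v n) \<in> D" "\<And>n. norm (x n - xbar) < e n" "\<And>n. v n + G (x n) \<noteq> 0"
    "\<And>n. norm (v n + G (x n)) \<le> e n * norm (x n - xbar)" "\<And>n. \<rho> n > 0"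
    and loc: "\<And>n x' v'. \<lbrakk>(x', v') \<in> D; norm ((x', v') - (x n, v n)) \<le> \<rho> n\<rbrakk> \<Longrightarrow>
       norm (v n + G (x n)) \<le> norm (v' + G x') + e n * norm ((x', v') - (x n, v n))"
    by metis
  have x0: "x \<longlonglongrightarrow> xbar"
    by (rule LIM_zero_cancel, rule Lim_null_comparison[OF _ e0]) (use xv(2) in \<open>auto intro!: always_eventually less_imp_le\<close>)
  have "norm (v n + G (x n)) \<le> e n" for n
  proof -
    have "e n \<le> 1" by (simp add: e_def divide_simps)
    then have "e n * norm (x n - xbar) \<le> e n * 1"
      using xv(2)[of n] e[of n] by (intro mult_left_mono) auto
    then show ?thesis using xv(4)[of n] by simp
  qed
  then have q0: "(\<lambda>n. v n + G (x n)) \<longlonglongrightarrow> 0"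
    by (intro Lim_null_comparison[OF _ e0] always_eventually) auto
  have "isCont G xbar" using E by (simp add: continuous_on_eq_continuous_at)
  from isCont_tendsto_compose[OF this x0] have Gx: "(\<lambda>n. G (x n)) \<longlonglongrightarrow> G xbar" .
  have v0: "v \<longlonglongrightarrow> - G xbar" using tendsto_diff[OF q0 Gx] by simp
  have zlim: "(\<lambda>n. (x n, v n)) \<longlonglongrightarrow> ?z" using x0 v0 by (rule tendsto_Pair)
  define \<eta>s where "\<eta>s n = sgn (v n + G (x n))" for n
  have "\<forall>n. \<eta>s n \<in> sphere 0 1" using xv(3) by (auto simp: \<eta>s_def norm_sgn)
  then obtain \<eta> s where s: "\<eta> \<in> sphere 0 1" "strict_mono s" "(\<eta>s \<circ> s) \<longlonglongrightarrow> \<eta>"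
    using compact_sphere[of "0::'a" 1] unfolding compact_def by metis
  have n\<eta>: "norm \<eta> = 1" using s by simp
  define h where "h x = G x \<bullet> \<eta>" for x
  \<comment> \<open>The residual map is Lipschitz with constant \<open>1 + L\<close>. Replacing
    \<open>\<eta>s n\<close> by \<open>\<eta>\<close> costs the first term; linearizing the norm
    costs \<open>e n * (1 + L)\<close> and the minimizer's penalty another \<open>e n\<close>.
    Convergence to 0 is available only along the subsequence \<open>s\<close>.\<close>
  define e' where "e' n = norm (\<eta>s n - \<eta>) * (1 + L) + e n * (2 + L)" for n
  have e'pos: "e' n > 0" for n
  proof -
    have "e n * (2 + L) > 0" using e[of n] L by (intro mult_pos_pos) auto
    moreover have "norm (\<eta>s n - \<eta>) * (1 + L) \<ge> 0" using L by simp
    ultimately show ?thesis unfolding e'_def by linarith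
  qed
  have e'0: "(e' \<circ> s) \<longlonglongrightarrow> 0"
  proof -
    have "(\<lambda>k. norm ((\<eta>s \<circ> s) k - \<eta>) * (1 + L) + (e \<circ> s) k * (2 + L)) \<longlonglongrightarrow> norm (\<eta> - \<eta>) * (1 + L) + 0 * (2 + L)"
      by (intro tendsto_intros s LIMSEQ_subseq_LIMSEQ[OF e0])
    then show ?thesis by (simp add: o_def e'_def)
  qed
  have step: "\<exists>u \<zeta> z w. norm (u - x n) \<le> e n \<and> norm \<zeta> \<le> 2 * L \<and> \<zeta> \<in> prox_subdiff (\<lambda>x. ereal (h x)) u \<and>
      z \<in> D \<and> norm (z - (x n, v n)) \<le> e n \<and> w \<in> regular_normal_cone D z \<and> norm (w - (- \<zeta>, - \<eta>)) \<le> 6 * e' n"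
    if n: "dist ?z (x n, v n) \<le> r1" "dist xbar (x n) \<le> r0 / 2" for n
  proof -
    let ?q = "v n + G (x n)"
    obtain d where d: "d > 0" "\<And>y. norm (y - ?q) < d \<Longrightarrow> norm (norm y - norm ?q - (y - ?q) \<bullet> \<eta>s n) \<le> e n * norm (y - ?q)"
      using has_derivative_norm[OF xv(3)[of n]] e[of n] unfolding has_derivative_at_alt \<eta>s_def by blast
    \<comment> \<open>The last bound keeps the residual, which moves by at most
      \<open>(1 + L) * R\<close>, inside the radius \<open>d\<close> where the norm is
      linearized.\<close>
    define R where "R = min (min (\<rho> n) r1) (min (r0/2) (d / (2 * (1 + L))))"
    have "d / (2 * (1 + L)) > 0" using d(1) L by simp
    then have R: "R > 0" "R \<le> \<rho> n" "R \<le> r1" "R \<le> r0/2" "R \<le> d / (2 * (1 + L))"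
      using xv(5)[of n] r0(1) r1(1) unfolding R_def by linarith+
    have "(1 + L) * R \<le> d/2" using R(5) L by (simp add: field_simps)
    then have Rd: "(1 + L) * R < d" using d(1) by linarith
    have sub: "cball (x n) R \<subseteq> U"
    proof
      fix y assume "y \<in> cball (x n) R"
      then have "dist xbar y \<le> r0" using dist_triangle[of xbar y "x n"] n(2) R(4) by simp
      then show "y \<in> U" using r0(2) by auto
    qed
    have GL: "norm (G a - G b) \<le> L * norm (a - b)" if "a \<in> cball (x n) R" "b \<in> cball (x n) R" for a b
      using lipschitz_onD[OF U(3) subsetD[OF sub that(1)] subsetD[OF sub that(2)]] by (simp add: dist_norm)
    have hL: "L-lipschitz_on (cball (x n) R) h"
    proof (rule lipschitz_onI[OF _ L])
      fix a b assume ab: "a \<in> cball (x n) R" "b \<in> cball (x n) R"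
      have "\<bar>(G a - G b) \<bullet> \<eta>\<bar> \<le> norm (G a - G b) * norm \<eta>" by (rule Cauchy_Schwarz_ineq2)
      then show "dist (h a) (h b) \<le> L * dist a b"
        using GL[OF ab] by (simp add: h_def dist_norm inner_diff_left n\<eta>)
    qed
    have lin: "\<eta> \<bullet> v n + h (x n) \<le> \<eta> \<bullet> v' + h x' + e' n * norm ((x', v') - (x n, v n))"
      if z': "(x', v') \<in> D \<inter> cball (x n, v n) R" for x' v'
    proof -
      define m where "m = norm ((x', v') - (x n, v n))"
      have m: "m \<le> R" "m \<ge> 0" using z' by (auto simp: m_def mem_cball_norm simp del: mem_cball)
      have nx: "norm (x' - x n) \<le> m" "norm (v' - v n) \<le> m"
        using norm_fst_le[of "x' - x n" "v' - v n"] norm_snd_le[of "v' - v n" "x' - x n"] by (auto simp: m_def)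
      define dq where "dq = (v' + G x') - ?q"
      have "dq = (v' - v n) + (G x' - G (x n))" by (simp add: dq_def)
      then have "norm dq \<le> norm (v' - v n) + norm (G x' - G (x n))" by (simp add: norm_triangle_ineq)
      also have "norm (G x' - G (x n)) \<le> L * norm (x' - x n)"
        using nx m R(1) by (intro GL) (auto simp: dist_norm norm_minus_commute)
      also have "\<dots> \<le> L * m" using nx L by (intro mult_left_mono)
      finally have ndq: "norm dq \<le> (1 + L) * m" using nx by (simp add: algebra_simps)
      also have "\<dots> \<le> (1 + L) * R" using m L by (intro mult_left_mono) auto
      finally have "norm dq < d" using Rd by simp
      from d(2)[of "v' + G x'"] this have "norm (v' + G x') \<le> norm ?q + dq \<bullet> \<eta>s n + e n * norm dq"
        by (simp add: dq_def)
      moreover have "norm ?q \<le> norm (v' + G x') + e n * m"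
        using loc[of x' v' n] z' m R(2) by (simp add: m_def)
      moreover have "e n * norm dq \<le> e n * ((1 + L) * m)" using ndq e[of n] by simp
      moreover have "dq \<bullet> \<eta>s n \<le> dq \<bullet> \<eta> + norm (\<eta>s n - \<eta>) * ((1 + L) * m)"
      proof -
        have "dq \<bullet> (\<eta>s n - \<eta>) \<le> norm dq * norm (\<eta>s n - \<eta>)" by (rule norm_cauchy_schwarz)
        also have "\<dots> \<le> (1 + L) * m * norm (\<eta>s n - \<eta>)" using ndq by (intro mult_right_mono) auto
        finally show ?thesis by (simp add: inner_diff_right algebra_simps)
      qed
      ultimately have "0 \<le> dq \<bullet> \<eta> + e' n * m" by (simp add: e'_def algebra_simps)
      then show ?thesis unfolding m_def[symmetric]
        by (simp add: dq_def h_def inner_diff_left inner_add_left inner_commute[of _ \<eta>] inner_diff_right inner_add_right)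
    qed
    have "closed (D \<inter> cball (x n, v n) R)" using r1(2)[OF n(1) R(3)] .
    from fuzzy_sum_rule[OF xv(1) R(1) this hL e'pos e lin] show ?thesis by metis
  qed
  have "eventually (\<lambda>n. dist (x n, v n) ?z < r1) sequentially" "eventually (\<lambda>n. dist (x n) xbar < r0/2) sequentially"
    using tendstoD[OF zlim r1(1)] tendstoD[OF x0, of "r0/2"] r0 by auto
  then have "eventually (\<lambda>n. dist ?z (x n, v n) \<le> r1 \<and> dist xbar (x n) \<le> r0 / 2) sequentially"
    by eventually_elim (simp only: dist_commute less_imp_le)
  then obtain N where N: "\<And>n. n \<ge> N \<Longrightarrow> dist ?z (x n, v n) \<le> r1 \<and> dist xbar (x n) \<le> r0 / 2"
    unfolding eventually_sequentially by blast
  \<comment> \<open>\<open>step\<close> holds only for indices whose points are close to the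
    reference point; the shift by \<open>N\<close> discards the others.\<close>
  define s' where "s' k = s (k + N)" for k
  have s': "strict_mono s'" "s' k \<ge> N" for k
    using s(2) seq_suble[OF s(2), of "k + N"] by (auto simp: s'_def strict_mono_def)
  obtain u \<zeta> z w where uz: "\<And>k. norm (u k - x (s' k)) \<le> e (s' k)" "\<And>k. norm (\<zeta> k) \<le> 2 * L"
      "\<And>k. \<zeta> k \<in> prox_subdiff (\<lambda>x. ereal (h x)) (u k)"
      "\<And>k. z k \<in> D" "\<And>k. norm (z k - (x (s' k), v (s' k))) \<le> e (s' k)"
      "\<And>k. w k \<in> regular_normal_cone D (z k)" "\<And>k. norm (w k - (- \<zeta> k, - \<eta>)) \<le> 6 * e' (s' k)"
    using step[OF N[OF s'(2), THEN conjunct1] N[OF s'(2), THEN conjunct2]] by metis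
  have "\<forall>k. \<zeta> k \<in> cball 0 (2 * L)" using uz(2) by simp
  then obtain \<zeta>' q where q: "strict_mono q" "(\<zeta> \<circ> q) \<longlonglongrightarrow> \<zeta>'"
    using compact_cball[of "0::'a" "2 * L"] unfolding compact_def by metis
  have es': "(\<lambda>k. e (s' k)) \<longlonglongrightarrow> 0" using LIMSEQ_subseq_LIMSEQ[OF e0 s'(1)] by (simp add: o_def)
  have ulim: "u \<longlonglongrightarrow> xbar"
  proof -
    have "(\<lambda>k. u k - x (s' k)) \<longlonglongrightarrow> 0"
      using uz(1) by (intro Lim_null_comparison[OF _ es'] always_eventually) auto
    from tendsto_add[OF this LIMSEQ_subseq_LIMSEQ[OF x0 s'(1)]] show ?thesis by (simp add: o_def)
  qed
  have zlim': "z \<longlonglongrightarrow> ?z"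
  proof -
    have "(\<lambda>k. z k - (x (s' k), v (s' k))) \<longlonglongrightarrow> 0"
      using uz(5) by (intro Lim_null_comparison[OF _ es'] always_eventually) auto
    from tendsto_add[OF this LIMSEQ_subseq_LIMSEQ[OF zlim s'(1)]] show ?thesis by (simp add: o_def)
  qed
  have wlim: "(w \<circ> q) \<longlonglongrightarrow> (- \<zeta>', - \<eta>)"
  proof -
    have "(\<lambda>k. 6 * (e' \<circ> s) (k + N)) \<longlonglongrightarrow> 6 * 0"
      by (intro tendsto_intros LIMSEQ_ignore_initial_segment[OF e'0])
    then have "(\<lambda>k. 6 * e' (s' k)) \<longlonglongrightarrow> 0" by (simp add: s'_def)
    then have "(\<lambda>k. w k - (- \<zeta> k, - \<eta>)) \<longlonglongrightarrow> 0"
      by (rule Lim_null_comparison[OF always_eventually[OF allI[OF uz(7)]]])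
    from LIMSEQ_subseq_LIMSEQ[OF this q(1)]
    have "(\<lambda>k. w (q k) - (- \<zeta> (q k), - \<eta>)) \<longlonglongrightarrow> 0" by (simp add: o_def)
    moreover have "(\<lambda>k. (- \<zeta> (q k), - \<eta>)) \<longlonglongrightarrow> (- \<zeta>', - \<eta>)"
      using q(2) by (intro tendsto_intros) (simp add: o_def)
    ultimately have "(\<lambda>k. w (q k) - (- \<zeta> (q k), - \<eta>) + (- \<zeta> (q k), - \<eta>)) \<longlonglongrightarrow> 0 + (- \<zeta>', - \<eta>)"
      by (rule tendsto_add)
    then show ?thesis by (simp only: diff_add_cancel add_0 o_def)
  qed
  have "(- \<zeta>', - \<eta>) \<in> limiting_normal_cone D ?z"
    unfolding limiting_normal_cone_def mem_Collect_eq
    by (rule conjI[OF D(2)], rule exI[of _ "z \<circ> q"], rule exI[of _ "w \<circ> q"])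
       (use wlim LIMSEQ_subseq_LIMSEQ[OF zlim' q(1)] uz(4,6) in auto)
  moreover have "\<zeta>' \<in> lim_subdiff (\<lambda>x. ereal (h x)) xbar"
  proof -
    have "isCont h xbar" unfolding h_def using \<open>isCont G xbar\<close> by (intro continuous_intros)
    then have hlim: "(\<lambda>k. h ((u \<circ> q) k)) \<longlonglongrightarrow> h xbar"
      using LIMSEQ_subseq_LIMSEQ[OF ulim q(1)] by (rule isCont_tendsto_compose)
    show ?thesis
      unfolding lim_subdiff_def mem_Collect_eq
      by (rule exI[of _ "u \<circ> q"], rule exI[of _ "\<zeta> \<circ> q"])
         (use hlim LIMSEQ_subseq_LIMSEQ[OF ulim q(1)] q(2) uz(3) in auto)
  qed
  \<comment> \<open>\<open>cq\<close> is used with \<open>\<xi> = - \<zeta>'\<close> and multiplier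
    \<open>- \<eta>\<close>; the two minus signs in its scalar function then cancel and leave
    \<open>h\<close>.\<close>
  ultimately have "(- \<zeta>', - \<eta>) = 0" by (intro cq) (simp_all add: h_def)
  with n\<eta> show False by (simp add: zero_prod_def)
qed

lemma tendsto_matrix_vector_mult:
  fixes A :: "nat \<Rightarrow> real^'n^'m"
  assumes "(\<lambda>k. A k) \<longlonglongrightarrow> B" "(\<lambda>k. y k) \<longlonglongrightarrow> b"
  shows "(\<lambda>k. A k *v y k) \<longlonglongrightarrow> B *v b"
  unfolding matrix_vector_mult_def
  by (intro vec_tendstoI) (auto intro!: tendsto_intros assms)

lemma tendsto_transpose:
  fixes A :: "nat \<Rightarrow> real^'n^'m"
  assumes "(\<lambda>k. A k) \<longlonglongrightarrow> B"
  shows "(\<lambda>k. transpose (A k)) \<longlonglongrightarrow> transpose B"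
  unfolding transpose_def by (intro vec_tendstoI) (auto intro!: tendsto_intros assms)

text \<open>The local minimizers come with \<open>\<parallel>v + G x\<parallel> = o(\<parallel>x - xbar\<parallel>)\<close>, so that they approach the reference
  point in a direction \<open>(a, - H a)\<close>. The normals live at points \<open>o(\<parallel>x - xbar\<parallel>)\<close> away from them.\<close>

lemma calm_of_directional_normals:
  fixes G :: "real^'n \<Rightarrow> real^'n"
  assumes E: "open E" "xbar \<in> E"
    and G: "\<And>x. x \<in> E \<Longrightarrow> (G has_derivative (\<lambda>h. H x *v h)) (at x)" "continuous_on E H"
    and D: "closed_near D (xbar, - G xbar)" "(xbar, - G xbar) \<in> D"
    and cq: "\<And>w \<xi> \<eta>. \<lbrakk>w \<noteq> 0; (w, - (H xbar *v w)) \<in> tangent_cone D (xbar, - G xbar);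
      \<xi> = transpose (H xbar) *v \<eta>;
      (\<xi>, \<eta>) \<in> directional_normal_cone D (xbar, - G xbar) (w, - (H xbar *v w))\<rbrakk> \<Longrightarrow> (\<xi>, \<eta>) = 0"
  shows "calm_at (\<lambda>p. {x\<in>E. (x, p - G x) \<in> D}) 0 xbar"
proof (rule ccontr)
  assume nc: "\<not> ?thesis"
  let ?z = "(xbar, - G xbar)"
  have contG: "continuous_on E G"
    using G(1) by (meson continuous_at_imp_continuous_on has_derivative_continuous)
  obtain r1 where r1: "r1 > 0" "\<And>y s. \<lbrakk>dist ?z y \<le> r1; s \<le> r1\<rbrakk> \<Longrightarrow> closed (D \<inter> cball y s)"
    by (rule closed_near_cball[OF D(1)]) (rule that)
  define e where "e n = inverse (real (Suc n))" for n
  have e: "e n > 0" for n by (simp add: e_def)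
  have e0: "e \<longlonglongrightarrow> 0" unfolding e_def by (rule LIMSEQ_inverse_real_of_nat)
  have "\<exists>x v \<rho>. x \<in> E \<and> (x, v) \<in> D \<and> 0 < norm (x - xbar) \<and> norm (x - xbar) < e n \<and> v + G x \<noteq> 0 \<and>
      norm (v + G x) \<le> e n * norm (x - xbar) \<and> \<rho> > 0 \<and>
      (\<forall>x' v'. (x', v') \<in> D \<and> norm ((x', v') - (x, v)) \<le> \<rho> \<longrightarrow>
       norm (v + G x) \<le> norm (v' + G x') + e n * norm ((x', v') - (x, v)))" for n
    by (rule not_calm_imp_local_minimizer[OF E contG D nc e[of n]]) blast
  then obtain x v \<rho> where xv: "\<And>n. x n \<in> E" "\<And>n. (x n, v n) \<in> D" "\<And>n. 0 < norm (x n - xbar)"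
    "\<And>n. norm (x n - xbar) < e n" "\<And>n. v n + G (x n) \<noteq> 0"
    "\<And>n. norm (v n + G (x n)) \<le> e n * norm (x n - xbar)" "\<And>n. \<rho> n > 0"
    and loc: "\<And>n x' v'. \<lbrakk>(x', v') \<in> D; norm ((x', v') - (x n, v n)) \<le> \<rho> n\<rbrakk> \<Longrightarrow>
       norm (v n + G (x n)) \<le> norm (v' + G x') + e n * norm ((x', v') - (x n, v n))"
    by metis
  define t where "t n = norm (x n - xbar)" for n
  have t: "t n > 0" for n using xv(3) by (simp add: t_def)
  have t0: "t \<longlonglongrightarrow> 0" unfolding t_def
    by (rule Lim_null_comparison[OF _ e0]) (use xv(4) in \<open>auto intro!: always_eventually less_imp_le\<close>)
  have x0: "x \<longlonglongrightarrow> xbar" using t0 unfolding t_def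
    by (rule LIM_zero_cancel[OF tendsto_norm_zero_cancel])
  have q0: "(\<lambda>n. (1 / t n) *\<^sub>R (v n + G (x n))) \<longlonglongrightarrow> 0"
  proof (intro Lim_null_comparison[OF _ e0] always_eventually allI)
    show "norm ((1 / t n) *\<^sub>R (v n + G (x n))) \<le> e n" for n
      using xv(6)[of n] t[of n] by (simp add: t_def divide_simps mult.commute)
  qed
  define a where "a n = (1 / t n) *\<^sub>R (x n - xbar)" for n
  have na: "norm (a n) = 1" for n using t[of n] by (simp add: a_def t_def)
  have G0: "(\<lambda>n. (1 / t n) *\<^sub>R (G (x n) - G xbar) - H xbar *v a n) \<longlonglongrightarrow> 0"
  proof -
    have "((\<lambda>y. (1 / norm (y - xbar)) *\<^sub>R (G y - (G xbar + H xbar *v (y - xbar)))) \<longlongrightarrow> 0) (at xbar)"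
      using G(1)[OF E(2)] unfolding has_derivative_within by (simp add: inverse_eq_divide)
    moreover have "filterlim x (at xbar) sequentially"
      using x0 xv(3) by (auto simp: filterlim_at intro!: always_eventually)
    ultimately have "(\<lambda>n. (1 / t n) *\<^sub>R (G (x n) - (G xbar + H xbar *v (x n - xbar)))) \<longlonglongrightarrow> 0"
      unfolding t_def by (rule filterlim_compose)
    moreover have "(1 / t n) *\<^sub>R (G (x n) - (G xbar + H xbar *v (x n - xbar)))
        = (1 / t n) *\<^sub>R (G (x n) - G xbar) - H xbar *v a n" for n
    proof -
      have "H xbar *v a n = (1 / t n) *\<^sub>R (H xbar *v (x n - xbar))"
        by (simp only: a_def matrix_vector_mult_scaleR)
      then show ?thesis by (simp add: algebra_simps)
    qed
    ultimately show ?thesis by simp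
  qed
  define \<eta>s where "\<eta>s n = sgn (v n + G (x n))" for n
  have n\<eta>: "norm (\<eta>s n) = 1" for n using xv(5) by (simp add: \<eta>s_def norm_sgn)
  \<comment> \<open>Working in the product gives one subsequence along which both the directions of
    approach and the unit residuals converge.\<close>
  have "compact (sphere (0::real^'n) 1 \<times> sphere (0::real^'n) 1)" by (intro compact_Times compact_sphere)
  moreover have "\<forall>n. (a n, \<eta>s n) \<in> sphere 0 1 \<times> sphere 0 1" using na n\<eta> by simp
  ultimately obtain l s where s: "l \<in> sphere 0 1 \<times> sphere 0 1" "strict_mono s" "((\<lambda>n. (a n, \<eta>s n)) \<circ> s) \<longlonglongrightarrow> l"
    unfolding compact_def by meson
  obtain a' \<eta> where l: "l = (a', \<eta>)" by force
  have a': "norm a' = 1" "norm \<eta> = 1" using s l by auto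
  have alim: "(\<lambda>k. a (s k)) \<longlonglongrightarrow> a'" and \<eta>lim: "(\<lambda>k. \<eta>s (s k)) \<longlonglongrightarrow> \<eta>"
    using tendsto_fst[OF s(3)] tendsto_snd[OF s(3)] by (auto simp: l o_def)
  \<comment> \<open>The tolerance \<open>e n * t n\<close> is negligible against \<open>t n\<close>,
    so passing from \<open>(x n, v n)\<close> to \<open>z\<close> does not alter the limiting
    direction.\<close>
  have step: "\<exists>z w. z \<in> D \<and> norm (z - (x n, v n)) \<le> e n * t n \<and> w \<in> regular_normal_cone D z \<and>
      norm (w - (- (transpose (H (x n)) *v \<eta>s n), - \<eta>s n)) \<le> 4 * e n" if n: "dist ?z (x n, v n) \<le> r1" for n
  proof -
    let ?zn = "(x n, v n)"
    \<comment> \<open>The negative gradient of the residual norm at \<open>?zn\<close>. The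
      minimizer's penalty and the linearization error contribute \<open>e n\<close> each, and the
      projection doubles their sum to \<open>4 * e n\<close>.\<close>
    let ?w = "(- (transpose (H (x n)) *v \<eta>s n), - \<eta>s n)"
    have "((\<lambda>z. G (fst z)) has_derivative (\<lambda>h. H (x n) *v fst h)) (at ?zn)"
      using has_derivative_compose[OF has_derivative_fst[OF has_derivative_ident], of G "\<lambda>h. H (x n) *v h" ?zn UNIV]
        G(1)[OF xv(1)[of n]] by simp
    then have "((\<lambda>z. snd z + G (fst z)) has_derivative (\<lambda>h. snd h + H (x n) *v fst h)) (at ?zn)"
      by (intro has_derivative_add has_derivative_snd[OF has_derivative_ident])
    then have "((\<lambda>z. norm (snd z + G (fst z))) has_derivative (\<lambda>h. (snd h + H (x n) *v fst h) \<bullet> \<eta>s n)) (at ?zn)"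
      using has_derivative_compose[of "\<lambda>z. snd z + G (fst z)" _ ?zn UNIV norm "\<lambda>h. h \<bullet> \<eta>s n"]
        has_derivative_norm[OF xv(5)[of n]] by (simp add: \<eta>s_def)
    then obtain d where d: "d > 0" "\<And>z. norm (z - ?zn) < d \<Longrightarrow>
        norm (norm (snd z + G (fst z)) - norm (v n + G (x n)) - (snd (z - ?zn) + H (x n) *v fst (z - ?zn)) \<bullet> \<eta>s n)
          \<le> e n * norm (z - ?zn)"
      using e[of n] unfolding has_derivative_at_alt by fastforce
    define R where "R = min (min (\<rho> n) r1) (d / 2)"
    have R: "R > 0" "R \<le> \<rho> n" "R \<le> r1" "R < d" using xv(7)[of n] r1 d by (auto simp: R_def)
    have "?w \<bullet> (z - ?zn) \<le> (2 * e n) * norm (z - ?zn)" if z: "z \<in> D \<inter> cball ?zn R" for z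
    proof -
      have nz: "norm (z - ?zn) \<le> R" using z by (simp add: mem_cball_norm del: mem_cball)
      have "norm (v n + G (x n)) \<le> norm (snd z + G (fst z)) + e n * norm (z - ?zn)"
        using loc[of "fst z" "snd z" n] z nz R(2) by simp
      moreover have "\<bar>norm (snd z + G (fst z)) - norm (v n + G (x n)) - (snd (z - ?zn) + H (x n) *v fst (z - ?zn)) \<bullet> \<eta>s n\<bar>
          \<le> e n * norm (z - ?zn)" using d(2)[of z] nz R(4) by simp
      ultimately have "- ((snd (z - ?zn) + H (x n) *v fst (z - ?zn)) \<bullet> \<eta>s n) \<le> (2 * e n) * norm (z - ?zn)"
        by (simp only: abs_le_iff) linarith
      moreover have "?w \<bullet> (z - ?zn) = - ((snd (z - ?zn) + H (x n) *v fst (z - ?zn)) \<bullet> \<eta>s n)"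
        by (simp add: inner_prod_def inner_add_left inner_add_right dot_lmul_matrix inner_commute[of _ "\<eta>s n"])
      ultimately show ?thesis by simp
    qed
    moreover have "closed (D \<inter> cball ?zn R)" using r1(2)[OF n R(3)] .
    moreover have "0 \<le> 2 * e n" "0 < e n * t n" using e[of n] t[of n] by auto
    ultimately obtain z w where zw: "z \<in> D" "norm (z - ?zn) \<le> e n * t n" "norm (w - ?w) \<le> 2 * (2 * e n)"
        "w \<in> regular_normal_cone D z"
      using regular_normal_near[OF xv(2)[of n] R(1), of "2 * e n" "e n * t n" ?w] by blast
    have "norm (w - ?w) \<le> 4 * e n" using zw(3) by linarith
    with zw show ?thesis by blast
  qed
  have Gx: "(\<lambda>n. G (x n)) \<longlonglongrightarrow> G xbar"
    using isCont_tendsto_compose[OF has_derivative_continuous[OF G(1)[OF E(2)]] x0] .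
  have "(\<lambda>n. t n *\<^sub>R ((1 / t n) *\<^sub>R (v n + G (x n)))) \<longlonglongrightarrow> 0 *\<^sub>R 0" by (intro tendsto_intros t0 q0)
  then have "(\<lambda>n. v n + G (x n)) \<longlonglongrightarrow> 0" using t by (simp add: less_imp_neq[symmetric])
  from tendsto_diff[OF this Gx] have v0: "v \<longlonglongrightarrow> - G xbar" by simp
  have "eventually (\<lambda>n. dist (x n, v n) ?z < r1) sequentially"
    by (intro tendstoD[OF _ r1(1)] tendsto_Pair x0 v0)
  then obtain N where N: "\<And>n. n \<ge> N \<Longrightarrow> dist ?z (x n, v n) \<le> r1"
    unfolding eventually_sequentially by (metis dist_commute less_imp_le)
  define s' where "s' k = s (k + N)" for k
  have s': "strict_mono s'" "s' k \<ge> N" for k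
    using s(2) seq_suble[OF s(2), of "k + N"] by (auto simp: s'_def strict_mono_def)
  have es': "(\<lambda>k. e (s' k)) \<longlonglongrightarrow> 0" and ts': "(\<lambda>k. t (s' k)) \<longlonglongrightarrow> 0" and xs': "(\<lambda>k. x (s' k)) \<longlonglongrightarrow> xbar"
    and qs': "(\<lambda>k. (1 / t (s' k)) *\<^sub>R (v (s' k) + G (x (s' k)))) \<longlonglongrightarrow> 0"
    and Gs': "(\<lambda>k. (1 / t (s' k)) *\<^sub>R (G (x (s' k)) - G xbar) - H xbar *v a (s' k)) \<longlonglongrightarrow> 0"
    using LIMSEQ_subseq_LIMSEQ[OF e0 s'(1)] LIMSEQ_subseq_LIMSEQ[OF t0 s'(1)] LIMSEQ_subseq_LIMSEQ[OF x0 s'(1)]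
      LIMSEQ_subseq_LIMSEQ[OF q0 s'(1)] LIMSEQ_subseq_LIMSEQ[OF G0 s'(1)] by (simp_all add: o_def)
  have as': "(\<lambda>k. a (s' k)) \<longlonglongrightarrow> a'" and \<eta>s': "(\<lambda>k. \<eta>s (s' k)) \<longlonglongrightarrow> \<eta>"
    unfolding s'_def using alim \<eta>lim by (auto intro: LIMSEQ_ignore_initial_segment)
  obtain z w where zw: "\<And>k. z k \<in> D" "\<And>k. norm (z k - (x (s' k), v (s' k))) \<le> e (s' k) * t (s' k)"
      "\<And>k. w k \<in> regular_normal_cone D (z k)"
      "\<And>k. norm (w k - (- (transpose (H (x (s' k))) *v \<eta>s (s' k)), - \<eta>s (s' k))) \<le> 4 * e (s' k)"
    using step[OF N[OF s'(2)]] by metis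
  define d where "d k = (1 / t (s' k)) *\<^sub>R (z k - ?z)" for k
  have zd: "?z + t (s' k) *\<^sub>R d k = z k" for k using t[of "s' k"] by (simp add: d_def)
  let ?dir = "(a', - (H xbar *v a'))"
  have dlim: "d \<longlonglongrightarrow> ?dir"
  proof -
    have "(\<lambda>k. (1 / t (s' k)) *\<^sub>R (z k - (x (s' k), v (s' k)))) \<longlonglongrightarrow> 0"
    proof (intro Lim_null_comparison[OF _ es'] always_eventually allI)
      show "norm ((1 / t (s' k)) *\<^sub>R (z k - (x (s' k), v (s' k)))) \<le> e (s' k)" for k
        using zw(2)[of k] t[of "s' k"] by (simp add: divide_simps)
    qed
    \<comment> \<open>This decomposes the scaled increment \<open>v + G xbar\<close>: the scaled
      residual vanishes, the derivative remainder vanishes, and \<open>- H xbar *v a'\<close> is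
      left as second component of the direction.\<close>
    moreover have "(\<lambda>k. (1 / t (s' k)) *\<^sub>R (v (s' k) + G (x (s' k))) - ((1 / t (s' k)) *\<^sub>R (G (x (s' k)) - G xbar)
        - H xbar *v a (s' k)) - H xbar *v a (s' k)) \<longlonglongrightarrow> 0 - 0 - H xbar *v a'"
      by (intro tendsto_diff qs' Gs' tendsto_matrix_vector_mult as' tendsto_const)
    ultimately have "(\<lambda>k. (1 / t (s' k)) *\<^sub>R (z k - (x (s' k), v (s' k))) + (a (s' k),
        (1 / t (s' k)) *\<^sub>R (v (s' k) + G (x (s' k))) - ((1 / t (s' k)) *\<^sub>R (G (x (s' k)) - G xbar)
        - H xbar *v a (s' k)) - H xbar *v a (s' k))) \<longlonglongrightarrow> 0 + (a', 0 - 0 - H xbar *v a')"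
      by (intro tendsto_add tendsto_Pair as')
    moreover have "(1 / t (s' k)) *\<^sub>R (z k - (x (s' k), v (s' k))) + (a (s' k),
        (1 / t (s' k)) *\<^sub>R (v (s' k) + G (x (s' k))) - ((1 / t (s' k)) *\<^sub>R (G (x (s' k)) - G xbar)
        - H xbar *v a (s' k)) - H xbar *v a (s' k)) = d k" for k
      by (cases "z k") (simp add: d_def a_def algebra_simps)
    ultimately show ?thesis by simp
  qed
  have wlim: "w \<longlonglongrightarrow> (- (transpose (H xbar) *v \<eta>), - \<eta>)"
  proof -
    have "(\<lambda>k. 4 * e (s' k)) \<longlonglongrightarrow> 4 * 0" by (intro tendsto_intros es')
    then have "(\<lambda>k. 4 * e (s' k)) \<longlonglongrightarrow> 0" by simp
    then have "(\<lambda>k. w k - (- (transpose (H (x (s' k))) *v \<eta>s (s' k)), - \<eta>s (s' k))) \<longlonglongrightarrow> 0"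
      by (rule Lim_null_comparison[OF always_eventually[OF allI[OF zw(4)]]])
    moreover have "isCont H xbar" using E G(2) by (simp add: continuous_on_eq_continuous_at)
    then have "(\<lambda>k. (- (transpose (H (x (s' k))) *v \<eta>s (s' k)), - \<eta>s (s' k))) \<longlonglongrightarrow> (- (transpose (H xbar) *v \<eta>), - \<eta>)"
      by (intro tendsto_Pair tendsto_minus tendsto_matrix_vector_mult tendsto_transpose \<eta>s'
          isCont_tendsto_compose[OF _ xs'])
    ultimately have "(\<lambda>k. w k - (- (transpose (H (x (s' k))) *v \<eta>s (s' k)), - \<eta>s (s' k))
        + (- (transpose (H (x (s' k))) *v \<eta>s (s' k)), - \<eta>s (s' k))) \<longlonglongrightarrow> 0 + (- (transpose (H xbar) *v \<eta>), - \<eta>)"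
      by (rule tendsto_add)
    then show ?thesis by (simp only: diff_add_cancel add_0)
  qed
  have tc: "?dir \<in> tangent_cone D ?z"
    unfolding tangent_cone_def mem_Collect_eq
    by (rule exI[of _ d], rule exI[of _ "\<lambda>k. t (s' k)"]) (use dlim t ts' zw(1) zd in auto)
  have dn: "(- (transpose (H xbar) *v \<eta>), - \<eta>) \<in> directional_normal_cone D ?z ?dir"
    unfolding directional_normal_cone_def mem_Collect_eq
    by (rule conjI[OF D(2)], rule exI[of _ "\<lambda>k. t (s' k)"], rule exI[of _ w], rule exI[of _ d])
       (use dlim wlim t ts' zw(3) zd in auto)
  have "(- (transpose (H xbar) *v \<eta>), - \<eta>) = 0"
    by (rule cq[OF _ tc linear_neg[OF matrix_vector_mul_linear, symmetric] dn]) (use a' in auto)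
  with a' show False by (simp add: zero_prod_def)
qed

section \<open>Gradients and Hessians\<close>

lemma grad_eqI:
  assumes "GDERIV \<phi> x :> d"
  shows "grad \<phi> x = d"
  unfolding grad_def
proof (rule the_equality)
  show "GDERIV \<phi> x :> d" by (rule assms)
  fix v assume "GDERIV \<phi> x :> v"
  then have "(\<lambda>h. h \<bullet> v) = (\<lambda>h. h \<bullet> d)"
    using assms unfolding gderiv_def by (rule has_derivative_unique)
  then show "v = d" by (metis vector_eq_ldot)
qed

text \<open>Riesz representation: a linear functional \<open>f'\<close> is the inner product with
  \<open>adjoint f' 1\<close>.\<close>

lemma GDERIV_grad:
  fixes \<phi> :: "'a::euclidean_space \<Rightarrow> real"
  assumes "\<phi> differentiable (at x)"
  shows "GDERIV \<phi> x :> grad \<phi> x"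
proof -
  obtain f' where f': "(\<phi> has_derivative f') (at x)" using assms unfolding differentiable_def by blast
  then have "linear f'" by (rule has_derivative_linear)
  then have "f' = (\<lambda>h. h \<bullet> adjoint f' 1)" by (simp add: adjoint_works)
  then have "GDERIV \<phi> x :> adjoint f' 1" using f' unfolding gderiv_def by simp
  then show ?thesis using grad_eqI by metis
qed

text \<open>The mean value theorem in the direction \<open>a\<close>, applied to the increment of
  \<open>\<phi>\<close> by \<open>s *\<^sub>R b\<close>, reduces the second difference to a first
  difference of \<open>G\<close>, which the derivative \<open>G'\<close> at \<open>x\<close>
  evaluates.\<close>

lemma second_difference_estimate:
  fixes \<phi> :: "'a::real_inner \<Rightarrow> real"
  assumes r: "r > 0" "\<And>y. y \<in> ball x r \<Longrightarrow> GDERIV \<phi> y :> G y"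
    and G': "(G has_derivative G') (at x)" and e: "e > 0"
  obtains \<delta> where "\<delta> > 0" "\<And>s. \<lbrakk>0 < s; s < \<delta>\<rbrakk> \<Longrightarrow>
    \<bar>\<phi> (x + s *\<^sub>R a + s *\<^sub>R b) - \<phi> (x + s *\<^sub>R a) - \<phi> (x + s *\<^sub>R b) + \<phi> x - s\<^sup>2 * (G' b \<bullet> a)\<bar>
      \<le> 2 * e * s\<^sup>2 * (norm a + norm b)\<^sup>2"
proof -
  interpret G': bounded_linear G' using G' by (rule has_derivative_bounded_linear)
  define M where "M = norm a + norm b"
  have M: "M \<ge> 0" "norm a \<le> M" by (auto simp: M_def)
  obtain d where d: "d > 0" "\<And>y. norm (y - x) < d \<Longrightarrow> norm (G y - G x - G' (y - x)) \<le> e * norm (y - x)"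
    using G' e unfolding has_derivative_at_alt by blast
  \<comment> \<open>All corner and intermediate points are then within
    \<open>s * M < min d r\<close> of \<open>x\<close>; the summand 1 covers
    \<open>M = 0\<close>.\<close>
  define \<delta> where "\<delta> = min d r / (M + 1)"
  have \<delta>: "\<delta> > 0" using d r M by (simp add: \<delta>_def)
  show ?thesis
  proof (rule that[OF \<delta>])
    fix s :: real assume s: "0 < s" "s < \<delta>"
    have "s * M \<le> s * (M + 1)" using s by simp
    also have "\<dots> < min d r" using s M by (simp add: \<delta>_def pos_less_divide_eq)
    finally have sM: "s * M < min d r" .
    have near: "norm (t *\<^sub>R a + c *\<^sub>R b) \<le> s * M" if "0 \<le> t" "t \<le> s" "0 \<le> c" "c \<le> s" for t c
    proof -
      have "norm (t *\<^sub>R a + c *\<^sub>R b) \<le> t * norm a + c * norm b"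
        using norm_triangle_ineq[of "t *\<^sub>R a" "c *\<^sub>R b"] that by simp
      also have "\<dots> \<le> s * norm a + s * norm b" using that by (intro add_mono mult_right_mono) auto
      finally show ?thesis by (simp add: M_def algebra_simps)
    qed
    define E where "E y = G y - G x - G' (y - x)" for y
    have E: "norm (E (x + t *\<^sub>R a + c *\<^sub>R b)) \<le> e * (s * M)" if "0 \<le> t" "t \<le> s" "0 \<le> c" "c \<le> s" for t c
    proof -
      have "norm (E (x + t *\<^sub>R a + c *\<^sub>R b)) \<le> e * norm (t *\<^sub>R a + c *\<^sub>R b)"
        using d(2)[of "x + t *\<^sub>R a + c *\<^sub>R b"] near[OF that] sM by (simp add: E_def add.assoc)
      also have "\<dots> \<le> e * (s * M)" using near[OF that] e by simp
      finally show ?thesis .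
    qed
    have der: "((\<lambda>t. \<phi> (x + t *\<^sub>R a + c *\<^sub>R b)) has_real_derivative (a \<bullet> G (x + t *\<^sub>R a + c *\<^sub>R b))) (at t)"
      if "0 \<le> t" "t \<le> s" "0 \<le> c" "c \<le> s" for t c
    proof -
      have "x - (x + t *\<^sub>R a + c *\<^sub>R b) = - (t *\<^sub>R a + c *\<^sub>R b)" by simp
      then have "x + t *\<^sub>R a + c *\<^sub>R b \<in> ball x r"
        using near[OF that] sM by (simp only: mem_ball dist_norm norm_minus_cancel)
      then have "(\<phi> has_derivative (\<lambda>h. h \<bullet> G (x + t *\<^sub>R a + c *\<^sub>R b))) (at (x + t *\<^sub>R a + c *\<^sub>R b))"
        using r(2) by (simp add: gderiv_def)
      moreover have "((\<lambda>t. x + t *\<^sub>R a + c *\<^sub>R b) has_derivative (\<lambda>h. h *\<^sub>R a)) (at t)"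
        by (auto intro!: derivative_eq_intros)
      ultimately have "((\<lambda>t. \<phi> (x + t *\<^sub>R a + c *\<^sub>R b)) has_derivative (\<lambda>h. (h *\<^sub>R a) \<bullet> G (x + t *\<^sub>R a + c *\<^sub>R b))) (at t)"
        by (rule has_derivative_compose[rotated])
      then show ?thesis by (simp add: has_field_derivative_def mult_commute_abs)
    qed
    let ?\<psi> = "\<lambda>t. \<phi> (x + t *\<^sub>R a + s *\<^sub>R b) - \<phi> (x + t *\<^sub>R a + 0 *\<^sub>R b)"
    have "\<exists>z. 0 < z \<and> z < s \<and> ?\<psi> s - ?\<psi> 0 = (s - 0) * (a \<bullet> G (x + z *\<^sub>R a + s *\<^sub>R b) - a \<bullet> G (x + z *\<^sub>R a + 0 *\<^sub>R b))"
      using s by (intro MVT2 DERIV_diff der) auto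
    then obtain z where z: "0 < z" "z < s"
      and eq: "?\<psi> s - ?\<psi> 0 = s * (a \<bullet> G (x + z *\<^sub>R a + s *\<^sub>R b) - a \<bullet> G (x + z *\<^sub>R a + 0 *\<^sub>R b))" by auto
    define e1 where "e1 = E (x + z *\<^sub>R a + s *\<^sub>R b)"
    define e2 where "e2 = E (x + z *\<^sub>R a + 0 *\<^sub>R b)"
    have "G (x + z *\<^sub>R a + s *\<^sub>R b) - G (x + z *\<^sub>R a + 0 *\<^sub>R b) = s *\<^sub>R G' b + (e1 - e2)"
      by (simp add: e1_def e2_def E_def G'.add G'.scaleR G'.diff algebra_simps)
    then have "?\<psi> s - ?\<psi> 0 = s * (a \<bullet> (s *\<^sub>R G' b + (e1 - e2)))"
      unfolding eq by (simp flip: inner_diff_right)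
    also have "\<dots> = s\<^sup>2 * (G' b \<bullet> a) + s * (a \<bullet> (e1 - e2))"
      by (simp add: inner_add_right inner_commute power2_eq_square algebra_simps)
    finally have "\<bar>?\<psi> s - ?\<psi> 0 - s\<^sup>2 * (G' b \<bullet> a)\<bar> = s * \<bar>a \<bullet> (e1 - e2)\<bar>"
      using s by (simp add: abs_mult)
    also have "\<dots> \<le> s * (norm a * norm (e1 - e2))"
      using s by (intro mult_left_mono Cauchy_Schwarz_ineq2) auto
    also have "\<dots> \<le> s * (M * (2 * (e * (s * M))))"
    proof -
      have "norm (e1 - e2) \<le> 2 * (e * (s * M))"
        using E[of z s] E[of z 0] z s norm_triangle_ineq4[of e1 e2] unfolding e1_def e2_def by linarith
      then show ?thesis using s M by (intro mult_left_mono[OF mult_mono]) auto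
    qed
    finally have "\<bar>?\<psi> s - ?\<psi> 0 - s\<^sup>2 * (G' b \<bullet> a)\<bar> \<le> s * (M * (2 * (e * (s * M))))" .
    moreover have "?\<psi> s - ?\<psi> 0 = \<phi> (x + s *\<^sub>R a + s *\<^sub>R b) - \<phi> (x + s *\<^sub>R a) - \<phi> (x + s *\<^sub>R b) + \<phi> x" by simp
    moreover have "s * (M * (2 * (e * (s * M)))) = 2 * e * s\<^sup>2 * (norm a + norm b)\<^sup>2"
      by (simp add: M_def[symmetric] power2_eq_square)
    ultimately show "\<bar>\<phi> (x + s *\<^sub>R a + s *\<^sub>R b) - \<phi> (x + s *\<^sub>R a) - \<phi> (x + s *\<^sub>R b) + \<phi> x - s\<^sup>2 * (G' b \<bullet> a)\<bar>
      \<le> 2 * e * s\<^sup>2 * (norm a + norm b)\<^sup>2" by simp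
  qed
qed

text \<open>The second difference is unchanged when \<open>a\<close> and \<open>b\<close> are
  exchanged, so both bilinear values approximate the same number; dividing by the square of
  \<open>s\<close> leaves an error proportional to the arbitrary \<open>e\<close>.\<close>

lemma second_derivative_symmetric:
  fixes \<phi> :: "'a::real_inner \<Rightarrow> real"
  assumes r: "r > 0" "\<And>y. y \<in> ball x r \<Longrightarrow> GDERIV \<phi> y :> G y"
    and G': "(G has_derivative G') (at x)"
  shows "G' a \<bullet> b = G' b \<bullet> a"
proof -
  define B where "B = (norm a + norm b)\<^sup>2"
  have "\<bar>G' b \<bullet> a - G' a \<bullet> b\<bar> \<le> 4 * e * B" if e: "e > 0" for e
  proof -
    obtain d1 where d1: "d1 > 0" "\<And>s. \<lbrakk>0 < s; s < d1\<rbrakk> \<Longrightarrow>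
      \<bar>\<phi> (x + s *\<^sub>R a + s *\<^sub>R b) - \<phi> (x + s *\<^sub>R a) - \<phi> (x + s *\<^sub>R b) + \<phi> x - s\<^sup>2 * (G' b \<bullet> a)\<bar>
        \<le> 2 * e * s\<^sup>2 * (norm a + norm b)\<^sup>2"
      by (rule second_difference_estimate[OF r(1) _ G' e, of \<phi> a b]) (erule r(2), rule that)
    obtain d2 where d2: "d2 > 0" "\<And>s. \<lbrakk>0 < s; s < d2\<rbrakk> \<Longrightarrow>
      \<bar>\<phi> (x + s *\<^sub>R b + s *\<^sub>R a) - \<phi> (x + s *\<^sub>R b) - \<phi> (x + s *\<^sub>R a) + \<phi> x - s\<^sup>2 * (G' a \<bullet> b)\<bar>
        \<le> 2 * e * s\<^sup>2 * (norm b + norm a)\<^sup>2"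
      by (rule second_difference_estimate[OF r(1) _ G' e, of \<phi> b a]) (erule r(2), rule that)
    obtain s where s: "0 < s" "s < min d1 d2" using d1(1) d2(1) dense[of 0 "min d1 d2"] by auto
    have comm: "x + s *\<^sub>R b + s *\<^sub>R a = x + s *\<^sub>R a + s *\<^sub>R b" by simp
    have "\<bar>\<phi> (x + s *\<^sub>R a + s *\<^sub>R b) - \<phi> (x + s *\<^sub>R a) - \<phi> (x + s *\<^sub>R b) + \<phi> x - s\<^sup>2 * (G' b \<bullet> a)\<bar> \<le> 2 * e * s\<^sup>2 * B"
      using d1(2)[of s] s by (simp add: B_def)
    moreover have "\<bar>\<phi> (x + s *\<^sub>R a + s *\<^sub>R b) - \<phi> (x + s *\<^sub>R b) - \<phi> (x + s *\<^sub>R a) + \<phi> x - s\<^sup>2 * (G' a \<bullet> b)\<bar> \<le> 2 * e * s\<^sup>2 * B"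
      using d2(2)[of s] s unfolding comm by (simp add: B_def add.commute)
    ultimately have "\<bar>s\<^sup>2 * (G' b \<bullet> a) - s\<^sup>2 * (G' a \<bullet> b)\<bar> \<le> 4 * e * s\<^sup>2 * B" by linarith
    then have "s\<^sup>2 * \<bar>G' b \<bullet> a - G' a \<bullet> b\<bar> \<le> s\<^sup>2 * (4 * e * B)"
      unfolding right_diff_distrib[symmetric] abs_mult by (simp add: mult_ac)
    then show ?thesis using s by simp
  qed
  then have "\<bar>G' b \<bullet> a - G' a \<bullet> b\<bar> \<le> 0 + e" if "e > 0" for e
  proof -
    have "B \<ge> 0" by (simp add: B_def)
    then have "4 * (e / (4 * (B + 1))) * B \<le> e" using that by (simp add: field_simps)
    moreover have "e / (4 * (B + 1)) > 0" using that \<open>B \<ge> 0\<close> by simp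
    ultimately show ?thesis using \<open>\<And>e. e > 0 \<Longrightarrow> \<bar>G' b \<bullet> a - G' a \<bullet> b\<bar> \<le> 4 * e * B\<close>[of "e / (4 * (B + 1))"] by linarith
  qed
  then have "\<bar>G' b \<bullet> a - G' a \<bullet> b\<bar> \<le> 0" by (rule field_le_epsilon)
  then show ?thesis by simp
qed

lemma C1_on_GDERIV:
  fixes \<phi> :: "'a::euclidean_space \<Rightarrow> real"
  assumes "C1_on S \<phi>" "x \<in> S"
  shows "GDERIV \<phi> x :> grad \<phi> x"
  using assms by (auto simp: C1_on_def intro: GDERIV_grad)

lemma C2_on_has_derivative_grad:
  assumes "C2_on S \<phi>" "x \<in> S"
  shows "(grad \<phi> has_derivative (\<lambda>h. hessian \<phi> x *v h)) (at x)"
  using assms jacobian_works unfolding C2_on_def hessian_def by blast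

text \<open>Reconciles the transposed Hessian of FOSCMS with the gradients of partial derivatives in
  the separable conditions, which are its rows.\<close>

lemma transpose_hessian:
  assumes "C2_on S \<phi>" "open S" "x \<in> S"
  shows "transpose (hessian \<phi> x) *v \<eta> = hessian \<phi> x *v \<eta>"
proof -
  obtain r where r: "r > 0" "ball x r \<subseteq> S" using assms open_contains_ball by blast
  have "GDERIV \<phi> y :> grad \<phi> y" if "y \<in> ball x r" for y
    using assms(1) that r(2) by (auto simp: C2_on_def intro: C1_on_GDERIV)
  from second_derivative_symmetric[OF r(1) this C2_on_has_derivative_grad[OF assms(1,3)]]
  have sym: "(hessian \<phi> x *v a) \<bullet> b = (hessian \<phi> x *v b) \<bullet> a" for a b .
  have "(transpose (hessian \<phi> x) *v \<eta>) \<bullet> h = (hessian \<phi> x *v \<eta>) \<bullet> h" for h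
    using sym[of h \<eta>] by (simp add: dot_lmul_matrix inner_commute[of \<eta>])
  then show ?thesis by (metis vector_eq_rdot)
qed

lemma partial_deriv_eq_grad:
  assumes "GDERIV \<phi> x :> d"
  shows "partial_deriv \<phi> i x = d $ i"
proof -
  have "(\<phi> has_derivative (\<lambda>h. h \<bullet> d)) (at (x + 0 *\<^sub>R axis i 1))" using assms by (simp add: gderiv_def)
  moreover have "((\<lambda>t. x + t *\<^sub>R axis i 1) has_derivative (\<lambda>h. h *\<^sub>R axis i 1)) (at (0::real))"
    by (auto intro!: derivative_eq_intros)
  ultimately have "((\<lambda>t. \<phi> (x + t *\<^sub>R axis i 1)) has_derivative (\<lambda>h. (h *\<^sub>R axis i 1) \<bullet> d)) (at 0)"
    by (rule has_derivative_compose[rotated])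
  then have "((\<lambda>t. \<phi> (x + t *\<^sub>R axis i 1)) has_real_derivative (d $ i)) (at 0)"
    by (simp add: has_field_derivative_def inner_axis' mult_commute_abs)
  then show ?thesis unfolding partial_deriv_def by (rule DERIV_imp_deriv)
qed

lemma grad_partial_deriv:
  assumes "C2_on S \<phi>" "open S" "x \<in> S"
  shows "grad (partial_deriv \<phi> i) x \<bullet> h = (hessian \<phi> x *v h) $ i"
proof -
  have "((\<lambda>y. grad \<phi> y $ i) has_derivative (\<lambda>h. (hessian \<phi> x *v h) $ i)) (at x)"
    using C2_on_has_derivative_grad[OF assms(1,3)]
    by (rule bounded_linear.has_derivative[OF bounded_linear_vec_nth])
  then have "((\<lambda>y. grad \<phi> y $ i) has_derivative (\<lambda>h. h \<bullet> (hessian \<phi> x $ i))) (at x)"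
    by (simp add: matrix_vector_mul_component inner_commute)
  moreover have "grad \<phi> y $ i = partial_deriv \<phi> i y" if "y \<in> S" for y
    using assms(1) that by (auto simp: C2_on_def intro!: partial_deriv_eq_grad[symmetric] C1_on_GDERIV)
  ultimately have "GDERIV (partial_deriv \<phi> i) x :> hessian \<phi> x $ i"
    unfolding gderiv_def using has_derivative_transform_within_open[OF _ assms(2,3)] by metis
  then show ?thesis by (simp add: grad_eqI matrix_vector_mul_component)
qed

section \<open>Proximal and limiting subgradients of smooth functions\<close>

text \<open>Subtracting the linear part given by \<open>\<zeta>\<close> and adding the proximal
  quadratic produces a function with a local minimum at \<open>y\<close>; its derivative there
  vanishes.\<close>

lemma prox_subdiff_differentiable:
  assumes "\<zeta> \<in> prox_subdiff (\<lambda>x. ereal (\<phi> x)) y" "GDERIV \<phi> y :> d"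
  shows "\<zeta> = d"
proof -
  obtain \<sigma> r where r: "\<sigma> > 0" "r > 0" "\<forall>x\<in>ball y r. ereal (\<phi> x) \<ge> ereal (\<phi> y) + ereal (\<zeta> \<bullet> (x - y) - \<sigma> * (norm (x - y))\<^sup>2)"
    using assms(1) unfolding prox_subdiff_def by blast
  define \<psi> where "\<psi> x = \<phi> x - (x - y) \<bullet> \<zeta> + \<sigma> * ((x - y) \<bullet> (x - y))" for x
  have "(\<phi> has_derivative (\<lambda>h. h \<bullet> d)) (at y)" using assms(2) by (simp add: gderiv_def)
  then have "(\<psi> has_derivative (\<lambda>h. h \<bullet> d - h \<bullet> \<zeta>)) (at y)"
    unfolding \<psi>_def by (auto intro!: derivative_eq_intros)
  moreover have "\<forall>x\<in>ball y r. \<psi> y \<le> \<psi> x"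
    using r(3) by (auto simp: \<psi>_def power2_norm_eq_inner inner_commute)
  ultimately have "(\<lambda>h. h \<bullet> d - h \<bullet> \<zeta>) = (\<lambda>h. 0)"
    using differential_zero_maxmin[of y "ball y r" \<psi>] r(2) by auto
  then have "h \<bullet> d = h \<bullet> \<zeta>" for h by (meson eq_iff_diff_eq_0)
  then show ?thesis by (metis vector_eq_ldot)
qed

lemma lim_subdiff_C1:
  assumes "open S" "x \<in> S" "\<And>y. y \<in> S \<Longrightarrow> GDERIV \<phi> y :> g y" "isCont g x"
    and "\<zeta> \<in> lim_subdiff (\<lambda>x. ereal (\<phi> x)) x"
  shows "\<zeta> = g x"
proof -
  obtain xs \<xi>s where xs: "xs \<longlonglongrightarrow> x" "\<And>k. \<xi>s k \<in> prox_subdiff (\<lambda>x. ereal (\<phi> x)) (xs k)" "\<xi>s \<longlonglongrightarrow> \<zeta>"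
    using assms(5) unfolding lim_subdiff_def by blast
  have "eventually (\<lambda>k. xs k \<in> S) sequentially" using topological_tendstoD[OF xs(1) assms(1,2)] .
  then have "eventually (\<lambda>k. g (xs k) = \<xi>s k) sequentially"
    by eventually_elim (use prox_subdiff_differentiable[OF xs(2) assms(3)] in auto)
  moreover have "(\<lambda>k. g (xs k)) \<longlonglongrightarrow> g x" using assms(4) xs(1) by (rule isCont_tendsto_compose)
  ultimately have "\<xi>s \<longlonglongrightarrow> g x" by (rule Lim_transform_eventually[rotated])
  with xs(3) show ?thesis by (rule LIMSEQ_unique)
qed

section \<open>Separable functions\<close>

lemma norm_axis: "norm (axis i a :: real^'n) = \<bar>a\<bar>"
  by (simp add: norm_eq_sqrt_inner inner_axis_axis)

text \<open>One direction perturbs a single coordinate. The other adds the coordinate inequalities,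
  using the smallest radius and the sum of the proximal constants, since each constant may have to
  multiply the whole squared norm.\<close>

lemma separable_prox_subdiff:
  assumes "separable g gs"
  shows "\<zeta> \<in> prox_subdiff g x \<longleftrightarrow> (\<forall>i. \<zeta> $ i \<in> prox_subdiff (gs i) (x $ i))"
proof
  have g: "g y = (\<Sum>i\<in>UNIV. gs i (y $ i))" for y using assms by (simp add: separable_def)
  have nm: "gs i t \<noteq> - \<infinity>" for i t using assms by (simp add: separable_def proper_def)
  {
    assume \<zeta>: "\<zeta> \<in> prox_subdiff g x"
    then have "g x < \<infinity>" by (simp add: prox_subdiff_def edom_def)
    then have fin: "gs i (x $ i) \<noteq> \<infinity>" for i by (auto simp: g sum_Pinfty)
    obtain \<sigma> r where r: "\<sigma> > 0" "r > 0" "\<And>y. y \<in> ball x r \<Longrightarrow> g y \<ge> g x + ereal (\<zeta> \<bullet> (y - x) - \<sigma> * (norm (y - x))\<^sup>2)"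
      using \<zeta> unfolding prox_subdiff_def by blast
    define c where "c i = real_of_ereal (gs i (x $ i))" for i
    have c: "gs i (x $ i) = ereal (c i)" for i
      using fin[of i] nm[of i "x $ i"] by (cases "gs i (x $ i)") (auto simp: c_def)
    show "\<forall>i. \<zeta> $ i \<in> prox_subdiff (gs i) (x $ i)"
    proof
      fix i
      have "gs i t \<ge> gs i (x $ i) + ereal (\<zeta> $ i \<bullet> (t - x $ i) - \<sigma> * (norm (t - x $ i))\<^sup>2)" if t: "t \<in> ball (x $ i) r" for t
      proof -
        define y where "y = x + axis i (t - x $ i)"
        have yx: "y - x = axis i (t - x $ i)" by (simp add: y_def)
        have nyx: "norm (y - x) = norm (t - x $ i)" by (simp add: yx norm_axis)
        have "y \<in> ball x r" using t nyx by (simp add: dist_norm norm_minus_commute)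
        from r(3)[OF this] have le: "g y \<ge> g x + ereal (\<zeta> $ i \<bullet> (t - x $ i) - \<sigma> * (norm (t - x $ i))\<^sup>2)"
          by (simp add: yx norm_axis inner_axis)
        \<comment> \<open>The unperturbed summands are finite at \<open>x\<close>, so they can be
          cancelled in the extended reals.\<close>
        have "g y = gs i t + (\<Sum>j\<in>UNIV - {i}. ereal (c j))"
          unfolding g by (subst sum.remove[of _ i]) (auto simp: y_def axis_def c intro!: arg_cong2[where f = "(+)"] sum.cong)
        moreover have "g x = ereal (c i) + (\<Sum>j\<in>UNIV - {i}. ereal (c j))"
          unfolding g by (subst sum.remove[of _ i]) (auto simp: c)
        ultimately show ?thesis using le nm[of i t] by (cases "gs i t") (auto simp: c)
      qed
      moreover have "x $ i \<in> edom (gs i)" using fin[of i] by (simp add: edom_def less_top[symmetric] top_ereal_def)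
      ultimately show "\<zeta> $ i \<in> prox_subdiff (gs i) (x $ i)"
        unfolding prox_subdiff_def using r(1,2) by blast
    qed
  }
  assume \<zeta>: "\<forall>i. \<zeta> $ i \<in> prox_subdiff (gs i) (x $ i)"
  then have fin: "gs i (x $ i) < \<infinity>" for i by (simp add: prox_subdiff_def edom_def)
  then have edom: "x \<in> edom g" by (auto simp: edom_def g less_top[symmetric] top_ereal_def sum_Pinfty)
  have "\<forall>i. \<exists>\<sigma> r. \<sigma> > 0 \<and> r > 0 \<and> (\<forall>t\<in>ball (x $ i) r. gs i t \<ge> gs i (x $ i) + ereal (\<zeta> $ i \<bullet> (t - x $ i) - \<sigma> * (norm (t - x $ i))\<^sup>2))"
    using \<zeta> unfolding prox_subdiff_def by blast
  then obtain \<sigma> r where r: "\<And>i. \<sigma> i > 0" "\<And>i. r i > 0"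
    "\<And>i t. t \<in> ball (x $ i) (r i) \<Longrightarrow> gs i t \<ge> gs i (x $ i) + ereal (\<zeta> $ i \<bullet> (t - x $ i) - \<sigma> i * (norm (t - x $ i))\<^sup>2)"
    by metis
  define R where "R = Min (range r)"
  have R: "R > 0" "\<And>i. R \<le> r i" using r(2) by (auto simp: R_def)
  have \<sigma>: "sum \<sigma> UNIV > 0" using r(1) by (intro sum_pos) auto
  have "g y \<ge> g x + ereal (\<zeta> \<bullet> (y - x) - sum \<sigma> UNIV * (norm (y - x))\<^sup>2)" if y: "y \<in> ball x R" for y
  proof -
    have "gs i (y $ i) \<ge> gs i (x $ i) + ereal (\<zeta> $ i \<bullet> (y $ i - x $ i) - \<sigma> i * (norm (y - x))\<^sup>2)" for i
    proof -
      have n: "\<bar>y $ i - x $ i\<bar> \<le> norm (y - x)" using component_le_norm_cart[of "y - x" i] by simp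
      then have "y $ i \<in> ball (x $ i) (r i)" using y R(2)[of i] by (simp add: dist_norm norm_minus_commute abs_minus_commute)
      from r(3)[OF this]
      have "gs i (x $ i) + ereal (\<zeta> $ i \<bullet> (y $ i - x $ i) - \<sigma> i * (norm (y $ i - x $ i))\<^sup>2) \<le> gs i (y $ i)" .
      moreover have "(norm (y $ i - x $ i))\<^sup>2 \<le> (norm (y - x))\<^sup>2" using n by (intro power_mono) auto
      then have "\<sigma> i * (norm (y $ i - x $ i))\<^sup>2 \<le> \<sigma> i * (norm (y - x))\<^sup>2" using r(1)[of i] by simp
      then have "gs i (x $ i) + ereal (\<zeta> $ i \<bullet> (y $ i - x $ i) - \<sigma> i * (norm (y - x))\<^sup>2)
        \<le> gs i (x $ i) + ereal (\<zeta> $ i \<bullet> (y $ i - x $ i) - \<sigma> i * (norm (y $ i - x $ i))\<^sup>2)"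
        by (intro add_left_mono) simp
      ultimately show ?thesis by simp
    qed
    then have "(\<Sum>i\<in>UNIV. gs i (x $ i) + ereal (\<zeta> $ i \<bullet> (y $ i - x $ i) - \<sigma> i * (norm (y - x))\<^sup>2)) \<le> g y"
      unfolding g by (intro sum_mono)
    moreover have "(\<Sum>i\<in>UNIV. gs i (x $ i) + ereal (\<zeta> $ i \<bullet> (y $ i - x $ i) - \<sigma> i * (norm (y - x))\<^sup>2))
        = g x + ereal (\<zeta> \<bullet> (y - x) - sum \<sigma> UNIV * (norm (y - x))\<^sup>2)"
      by (simp add: sum.distrib g inner_vec_def sum_subtractf sum_distrib_right)
    ultimately show ?thesis by simp
  qed
  then show "\<zeta> \<in> prox_subdiff g x" unfolding prox_subdiff_def using edom \<sigma> R(1) by blast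
qed

section \<open>Tangent and normal cones of a product of planar sets\<close>

text \<open>Regrouping the coordinates of \<open>(x, v)\<close> into planar pairs turns the graph
  for a separable \<open>g\<close> into a product of the graphs for the \<open>gs i\<close>.\<close>

definition pair_nth :: "(real^'n) \<times> (real^'n) \<Rightarrow> 'n \<Rightarrow> real \<times> real" where
  "pair_nth z i = (fst z $ i, snd z $ i)"

lemma pair_nth_add_scaleR: "pair_nth (z + t *\<^sub>R d) i = pair_nth z i + t *\<^sub>R pair_nth d i"
  by (simp add: pair_nth_def)

lemma tendsto_pair_nth:
  assumes "(f \<longlongrightarrow> l) F"
  shows "((\<lambda>k. pair_nth (f k) i) \<longlongrightarrow> pair_nth l i) F"
  unfolding pair_nth_def using assms by (intro tendsto_intros)

lemma gph_separable:
  assumes "separable g gs"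
  shows "z \<in> gph (prox_subdiff g) \<longleftrightarrow> (\<forall>i. pair_nth z i \<in> gph (prox_subdiff (gs i)))"
  using separable_prox_subdiff[OF assms] by (cases z) (auto simp: gph_def pair_nth_def)

context
  fixes D :: "((real^'n) \<times> (real^'n)) set" and Ds :: "'n \<Rightarrow> (real \<times> real) set"
  assumes D: "z \<in> D \<longleftrightarrow> (\<forall>i. pair_nth z i \<in> Ds i)"
begin

text \<open>Changing only the pair with index \<open>i\<close> to another point of
  \<open>Ds i\<close> stays in \<open>D\<close> and is an isometric perturbation, so the defining
  inequality for \<open>D\<close> restricts to that factor.\<close>

lemma regular_normal_cone_component:
  assumes "w \<in> regular_normal_cone D z"
  shows "pair_nth w i \<in> regular_normal_cone (Ds i) (pair_nth z i)"
proof -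
  let ?p = "pair_nth z i"
  have z: "z \<in> D" using assms by (simp add: regular_normal_cone_def)
  have "eventually (\<lambda>q. pair_nth w i \<bullet> (q - ?p) \<le> e * norm (q - ?p)) (at ?p within Ds i)" if "e > 0" for e
  proof -
    obtain d where d: "d > 0" "\<And>y. y \<in> D \<Longrightarrow> y \<noteq> z \<Longrightarrow> dist y z < d \<Longrightarrow> w \<bullet> (y - z) \<le> e * norm (y - z)"
      using assms \<open>e > 0\<close> unfolding regular_normal_cone_def eventually_at by blast
    show ?thesis
      unfolding eventually_at
    proof (intro exI[of _ d] conjI ballI impI)
      fix q assume q: "q \<in> Ds i" "q \<noteq> ?p \<and> dist q ?p < d"
      define y where "y = z + (axis i (fst (q - ?p)), axis i (snd (q - ?p)))"
      have yz: "y - z = (axis i (fst (q - ?p)), axis i (snd (q - ?p)))" by (simp add: y_def)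
      have n: "norm (y - z) = norm (q - ?p)"
        unfolding yz by (cases "q - ?p") (simp add: norm_Pair norm_axis)
      have "pair_nth y j = (if j = i then q else pair_nth z j)" for j
        by (cases q) (auto simp: y_def pair_nth_def axis_def)
      then have "y \<in> D" using z q(1) by (simp add: D)
      moreover have "y \<noteq> z" using n q(2) by auto
      moreover have "dist y z < d" using n q(2) by (simp add: dist_norm)
      ultimately have "w \<bullet> (y - z) \<le> e * norm (y - z)" by (rule d(2))
      moreover have "w \<bullet> (y - z) = pair_nth w i \<bullet> (q - ?p)"
        unfolding yz by (simp add: inner_prod_def inner_axis pair_nth_def)
      ultimately show "pair_nth w i \<bullet> (q - ?p) \<le> e * norm (q - ?p)" by (simp add: n)
    qed (rule d(1))
  qed
  then show ?thesis using z D by (simp add: regular_normal_cone_def)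
qed

lemma limiting_normal_cone_component:
  assumes "w \<in> limiting_normal_cone D z"
  shows "pair_nth w i \<in> limiting_normal_cone (Ds i) (pair_nth z i)"
proof -
  obtain zs vs where *: "z \<in> D" "zs \<longlonglongrightarrow> z" "vs \<longlonglongrightarrow> w" "\<And>k. zs k \<in> D \<and> vs k \<in> regular_normal_cone D (zs k)"
    using assms unfolding limiting_normal_cone_def by blast
  then have "pair_nth (zs k) i \<in> Ds i \<and> pair_nth (vs k) i \<in> regular_normal_cone (Ds i) (pair_nth (zs k) i)" for k
    using D regular_normal_cone_component by blast
  moreover have "pair_nth z i \<in> Ds i" using * D by blast
  ultimately show ?thesis
    unfolding limiting_normal_cone_def using tendsto_pair_nth[OF *(2)] tendsto_pair_nth[OF *(3)] by blast
qed

lemma tangent_cone_component: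
  assumes "w \<in> tangent_cone D z"
  shows "pair_nth w i \<in> tangent_cone (Ds i) (pair_nth z i)"
proof -
  obtain us t where *: "us \<longlonglongrightarrow> w" "\<forall>k. t k > 0" "t \<longlonglongrightarrow> 0" "\<And>k. z + t k *\<^sub>R us k \<in> D"
    using assms unfolding tangent_cone_def by blast
  have "\<forall>k. pair_nth z i + t k *\<^sub>R pair_nth (us k) i \<in> Ds i"
    using *(4) D by (simp flip: pair_nth_add_scaleR)
  then show ?thesis unfolding tangent_cone_def using tendsto_pair_nth[OF *(1)] *(2,3) by blast
qed

lemma directional_normal_cone_component:
  assumes "w \<in> directional_normal_cone D z d"
  shows "pair_nth w i \<in> directional_normal_cone (Ds i) (pair_nth z i) (pair_nth d i)"
proof -
  obtain t vs ds where *: "z \<in> D" "\<forall>k. t k > 0" "t \<longlonglongrightarrow> 0" "vs \<longlonglongrightarrow> w" "ds \<longlonglongrightarrow> d"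
    "\<And>k. vs k \<in> regular_normal_cone D (z + t k *\<^sub>R ds k)"
    using assms unfolding directional_normal_cone_def by blast
  have "\<forall>k. pair_nth (vs k) i \<in> regular_normal_cone (Ds i) (pair_nth z i + t k *\<^sub>R pair_nth (ds k) i)"
    using regular_normal_cone_component[OF *(6)] by (simp add: pair_nth_add_scaleR)
  moreover have "pair_nth z i \<in> Ds i" using * D by blast
  ultimately show ?thesis
    unfolding directional_normal_cone_def
    using tendsto_pair_nth[OF *(4)] tendsto_pair_nth[OF *(5)] *(2,3) by blast
qed

end

section \<open>Qualification conditions for separable functions\<close>

lemma S_cano_eq: "S_cano f g = (\<lambda>p. {x \<in> edom f. (x, p - egrad f x) \<in> gph (prox_subdiff g)})"
  by (auto simp: S_cano_def gph_def fun_eq_iff set_minus_plus)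

text \<open>For smooth gradients the limiting subdifferential contains at most
  \<open>- (ehessian f xbar *v \<eta>)\<close>, which forces \<open>\<xi>\<close> to be the Hessian
  times \<open>\<eta>\<close>. Its coordinates are the equations of \<open>cq\<close>, and normals
  to the product split into normals to the factors.\<close>

lemma NNAMCQ_separable:
  fixes f g :: "real^'n \<Rightarrow> ereal"
  assumes E: "open (edom f)" "xbar \<in> edom f" and C2: "C2_on (edom f) (real_of_ereal \<circ> f)"
    and sep: "separable g gs"
    and cq: "\<forall>\<xi> \<eta> :: real^'n.
           (\<forall>i. 0 = \<xi> $ i - grad (epartial f i) xbar \<bullet> \<eta> \<and>
                (\<xi> $ i, \<eta> $ i) \<in> limiting_normal_cone (gph (prox_subdiff (gs i)))
                                  (xbar $ i, - epartial f i xbar))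
           \<longrightarrow> (\<xi>, \<eta>) = 0"
  shows "NNAMCQ f g xbar"
  unfolding NNAMCQ_def
proof (intro allI impI, elim conjE)
  fix \<xi> \<eta> :: "real^'n"
  assume 0: "0 \<in> \<xi> +o lim_subdiff (\<lambda>x. ereal (- (egrad f x \<bullet> \<eta>))) xbar"
    and N: "(\<xi>, \<eta>) \<in> limiting_normal_cone (gph (prox_subdiff g)) (xbar, - egrad f xbar)"
  have C1: "C1_on (edom f) (real_of_ereal \<circ> f)" using C2 by (simp add: C2_on_def)
  have "- \<xi> \<in> lim_subdiff (\<lambda>x. ereal (- (egrad f x \<bullet> \<eta>))) xbar"
    using 0 by (simp flip: set_minus_plus)
  \<comment> \<open>Differentiation gives the adjoint of the Hessian acting on
    \<open>\<eta>\<close>; symmetry removes the transpose.\<close>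
  moreover have "GDERIV (\<lambda>x. - (egrad f x \<bullet> \<eta>)) y :> - (ehessian f y *v \<eta>)" if "y \<in> edom f" for y
  proof -
    have "((\<lambda>x. - (egrad f x \<bullet> \<eta>)) has_derivative (\<lambda>h. - ((ehessian f y *v h) \<bullet> \<eta>))) (at y)"
      using C2_on_has_derivative_grad[OF C2 that] by (intro derivative_intros)
    moreover have "(ehessian f y *v h) \<bullet> \<eta> = h \<bullet> (ehessian f y *v \<eta>)" for h
    proof -
      have "(ehessian f y *v h) \<bullet> \<eta> = (transpose (ehessian f y) *v \<eta>) \<bullet> h"
        by (simp add: dot_lmul_matrix inner_commute[of _ \<eta>])
      then show ?thesis by (simp only: transpose_hessian[OF C2 E(1) that] inner_commute[of h])
    qed
    ultimately show ?thesis by (simp add: gderiv_def)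
  qed
  moreover have "isCont (\<lambda>y. - (ehessian f y *v \<eta>)) xbar"
  proof (rule continuous_at_sequentiallyI)
    fix u assume "u \<longlonglongrightarrow> xbar"
    moreover have "isCont (ehessian f) xbar" using C2 E by (simp add: C2_on_def continuous_on_eq_continuous_at)
    ultimately show "(\<lambda>k. - (ehessian f (u k) *v \<eta>)) \<longlonglongrightarrow> - (ehessian f xbar *v \<eta>)"
      by (intro tendsto_minus tendsto_matrix_vector_mult isCont_tendsto_compose[of xbar "ehessian f"] tendsto_const)
  qed
  ultimately have "- \<xi> = - (ehessian f xbar *v \<eta>)" using lim_subdiff_C1[OF E] by metis
  then have \<xi>: "\<xi> = ehessian f xbar *v \<eta>" by simp
  show "(\<xi>, \<eta>) = 0"
  proof (rule cq[rule_format])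
    fix i
    show "0 = \<xi> $ i - grad (epartial f i) xbar \<bullet> \<eta> \<and>
        (\<xi> $ i, \<eta> $ i) \<in> limiting_normal_cone (gph (prox_subdiff (gs i))) (xbar $ i, - epartial f i xbar)"
      using limiting_normal_cone_component[OF gph_separable[OF sep] N, of i]
        partial_deriv_eq_grad[OF C1_on_GDERIV[OF C1 E(2)], of i] grad_partial_deriv[OF C2 E, of i \<eta>]
      by (simp add: pair_nth_def \<xi>)
  qed
qed

text \<open>Tangents and directional normals of the product project to its factors, so any joint
  violation of FOSCMS yields componentwise data to which \<open>cq\<close> applies.\<close>

lemma FOSCMS_separable:
  fixes f g :: "real^'n \<Rightarrow> ereal"
  assumes E: "open (edom f)" "xbar \<in> edom f" and C2: "C2_on (edom f) (real_of_ereal \<circ> f)"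
    and sep: "separable g gs"
    and cq: "\<forall>w. w \<noteq> 0 \<and>
           (\<forall>i. (w $ i, - (grad (epartial f i) xbar \<bullet> w)) \<in> tangent_cone (gph (prox_subdiff (gs i)))
                                  (xbar $ i, - epartial f i xbar))
         \<longrightarrow> (\<forall>\<xi> \<eta> :: real^'n.
           (\<forall>i. 0 = \<xi> $ i - grad (epartial f i) xbar \<bullet> \<eta> \<and>
                (\<xi> $ i, \<eta> $ i) \<in> directional_normal_cone (gph (prox_subdiff (gs i)))
                                  (xbar $ i, - epartial f i xbar)
                                  (w $ i, - (grad (epartial f i) xbar \<bullet> w)))
           \<longrightarrow> (\<xi>, \<eta>) = 0)"
  shows "FOSCMS f g xbar"
  unfolding FOSCMS_def
proof (intro conjI C2 allI impI, elim conjE)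
  fix w \<xi> \<eta> :: "real^'n"
  assume w: "w \<noteq> 0"
    and T: "(w, - (ehessian f xbar *v w)) \<in> tangent_cone (gph (prox_subdiff g)) (xbar, - egrad f xbar)"
    and \<xi>: "0 = \<xi> - transpose (ehessian f xbar) *v \<eta>"
    and N: "(\<xi>, \<eta>) \<in> directional_normal_cone (gph (prox_subdiff g)) (xbar, - egrad f xbar)
      (w, - (ehessian f xbar *v w))"
  have C1: "C1_on (edom f) (real_of_ereal \<circ> f)" using C2 by (simp add: C2_on_def)
  have \<xi>': "\<xi> = ehessian f xbar *v \<eta>"
    using \<xi> unfolding transpose_hessian[OF C2 E] by simp
  note eqs = partial_deriv_eq_grad[OF C1_on_GDERIV[OF C1 E(2)]] grad_partial_deriv[OF C2 E]
  show "(\<xi>, \<eta>) = 0"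
  proof (rule cq[rule_format, of w], intro conjI allI)
    show "w \<noteq> 0" by (rule w)
    fix i
    show "(w $ i, - (grad (epartial f i) xbar \<bullet> w)) \<in> tangent_cone (gph (prox_subdiff (gs i)))
        (xbar $ i, - epartial f i xbar)"
      using tangent_cone_component[OF gph_separable[OF sep] T, of i] by (simp add: pair_nth_def eqs)
    show "0 = \<xi> $ i - grad (epartial f i) xbar \<bullet> \<eta> \<and>
        (\<xi> $ i, \<eta> $ i) \<in> directional_normal_cone (gph (prox_subdiff (gs i))) (xbar $ i, - epartial f i xbar)
          (w $ i, - (grad (epartial f i) xbar \<bullet> w))"
      using directional_normal_cone_component[OF gph_separable[OF sep] N, of i]
      by (simp add: pair_nth_def eqs \<xi>')
  qed
qed

theorem theorem5p3:
  fixes f g :: "real^'n \<Rightarrow> ereal" and xbar :: "real^'n"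
  assumes "proper f" and "lsc f" and "proper g" and "lsc g"
    and "open (edom f)" and "C1_on (edom f) (real_of_ereal \<circ> f)"
    and "xbar \<in> prox_stationary f g"
    and "lipschitz_around (egrad f) (edom f) xbar"
    and "closed_near (gph (prox_subdiff g)) (xbar, - egrad f xbar)"
  shows
    "((piecewise_affine_on (edom f) (egrad f) \<and> polyhedral_multifunction (prox_subdiff g))
        \<or> NNAMCQ f g xbar \<or> FOSCMS f g xbar
      \<longrightarrow> calm_at (S_cano f g) 0 xbar)
     \<and>
     (\<forall>gs. separable g gs \<and> C2_on (edom f) (real_of_ereal \<circ> f) \<and>
        (\<forall>\<xi> \<eta> :: real^'n.
           (\<forall>i. 0 = \<xi> $ i - grad (epartial f i) xbar \<bullet> \<eta> \<and>
                (\<xi> $ i, \<eta> $ i) \<in> limiting_normal_cone (gph (prox_subdiff (gs i)))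
                                  (xbar $ i, - epartial f i xbar))
           \<longrightarrow> (\<xi>, \<eta>) = 0)
      \<longrightarrow> NNAMCQ f g xbar)
     \<and>
     (\<forall>gs. separable g gs \<and> C2_on (edom f) (real_of_ereal \<circ> f) \<and>
        (\<forall>w. w \<noteq> 0 \<and>
           (\<forall>i. (w $ i, - (grad (epartial f i) xbar \<bullet> w)) \<in> tangent_cone (gph (prox_subdiff (gs i)))
                                  (xbar $ i, - epartial f i xbar))
         \<longrightarrow> (\<forall>\<xi> \<eta> :: real^'n.
           (\<forall>i. 0 = \<xi> $ i - grad (epartial f i) xbar \<bullet> \<eta> \<and>
                (\<xi> $ i, \<eta> $ i) \<in> directional_normal_cone (gph (prox_subdiff (gs i)))
                                  (xbar $ i, - epartial f i xbar)
                                  (w $ i, - (grad (epartial f i) xbar \<bullet> w)))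
           \<longrightarrow> (\<xi>, \<eta>) = 0))
      \<longrightarrow> FOSCMS f g xbar)"
proof (intro conjI impI allI)
  let ?G = "egrad f" and ?D = "gph (prox_subdiff g)"
  have E: "open (edom f)" "xbar \<in> edom f" and xD: "(xbar, - ?G xbar) \<in> ?D"
    using assms by (auto simp: prox_stationary_def gph_def simp flip: set_minus_plus)
  have cont: "continuous_on (edom f) ?G" using assms(6) by (simp add: C1_on_def)
  show "calm_at (S_cano f g) 0 xbar"
    if "(piecewise_affine_on (edom f) ?G \<and> polyhedral_multifunction (prox_subdiff g)) \<or>
      NNAMCQ f g xbar \<or> FOSCMS f g xbar"
    using that
  proof (elim disjE conjE)
    assume "piecewise_affine_on (edom f) ?G" "polyhedral_multifunction (prox_subdiff g)"
    then show ?thesis unfolding S_cano_eq using E xD by (intro calm_polyhedral) (auto simp: gph_def)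
  next
    assume cq: "NNAMCQ f g xbar"
    show ?thesis unfolding S_cano_eq
    proof (rule calm_of_limiting_normals[OF E cont assms(9) xD assms(8)])
      fix \<xi> \<eta>
      assume "- \<xi> \<in> lim_subdiff (\<lambda>x. ereal (- (?G x \<bullet> \<eta>))) xbar"
        "(\<xi>, \<eta>) \<in> limiting_normal_cone ?D (xbar, - ?G xbar)"
      then show "(\<xi>, \<eta>) = 0" using cq unfolding NNAMCQ_def by (simp flip: set_minus_plus)
    qed
  next
    assume cq: "FOSCMS f g xbar"
    then have C2: "C2_on (edom f) (real_of_ereal \<circ> f)" by (simp add: FOSCMS_def)
    then have "continuous_on (edom f) (ehessian f)" by (simp add: C2_on_def)
    from E C2_on_has_derivative_grad[OF C2] this assms(9) xD show ?thesis unfolding S_cano_eq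
    proof (rule calm_of_directional_normals)
      fix w \<xi> \<eta>
      assume "w \<noteq> 0" "(w, - (ehessian f xbar *v w)) \<in> tangent_cone ?D (xbar, - ?G xbar)"
        "\<xi> = transpose (ehessian f xbar) *v \<eta>"
        "(\<xi>, \<eta>) \<in> directional_normal_cone ?D (xbar, - ?G xbar) (w, - (ehessian f xbar *v w))"
      then show "(\<xi>, \<eta>) = 0" using cq unfolding FOSCMS_def by (metis diff_self)
    qed
  qed
next
  fix gs assume "separable g gs \<and> C2_on (edom f) (real_of_ereal \<circ> f) \<and> (\<forall>\<xi> \<eta> :: real^'n.
           (\<forall>i. 0 = \<xi> $ i - grad (epartial f i) xbar \<bullet> \<eta> \<and>
                (\<xi> $ i, \<eta> $ i) \<in> limiting_normal_cone (gph (prox_subdiff (gs i)))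
                                  (xbar $ i, - epartial f i xbar))
           \<longrightarrow> (\<xi>, \<eta>) = 0)"
  with assms(5,7) show "NNAMCQ f g xbar"
    unfolding prox_stationary_def by (intro NNAMCQ_separable[of f xbar g gs]) blast+
next
  fix gs assume "separable g gs \<and> C2_on (edom f) (real_of_ereal \<circ> f) \<and> (\<forall>w. w \<noteq> 0 \<and>
           (\<forall>i. (w $ i, - (grad (epartial f i) xbar \<bullet> w)) \<in> tangent_cone (gph (prox_subdiff (gs i)))
                                  (xbar $ i, - epartial f i xbar))
         \<longrightarrow> (\<forall>\<xi> \<eta> :: real^'n.
           (\<forall>i. 0 = \<xi> $ i - grad (epartial f i) xbar \<bullet> \<eta> \<and>
                (\<xi> $ i, \<eta> $ i) \<in> directional_normal_cone (gph (prox_subdiff (gs i)))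
                                  (xbar $ i, - epartial f i xbar)
                                  (w $ i, - (grad (epartial f i) xbar \<bullet> w)))
           \<longrightarrow> (\<xi>, \<eta>) = 0))"
  with assms(5,7) show "FOSCMS f g xbar"
    unfolding prox_stationary_def by (intro FOSCMS_separable[of f xbar g gs]) blast+
qed

end
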